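(* There exist infinitely many (pairwise non-isomorphic) finite connected bipartite graphs $\Gamma$ of valency $3$, each admitting a subgroup $G\leq \mathrm{Aut}(\Gamma)$ such that $\Gamma$ is $(G,2)$-arc transitive, $G$ is biquasiprimitive on the vertex set of $\Gamma$, but $G^+$ is not quasiprimitive on either bipartite half of $\Gamma$.
   Context: Graphs are simple and undirected. An $s$-arc of a graph is an $(s+1)$-tuple $(v_0,\dots,v_s)$ of vertices with $v_i$ adjacent to $v_{i-1}$ for $1\le i\le s$ and $v_{j-1}\ne v_{j+1}$ for $1\le j\le s-1$. For a connected graph $\Gamma$ and $G\le\mathrm{Aut}(\Gamma)$, $\Gamma$ is $(G,s)$-arc transitive if $\Gamma$ has at least one $s$-arc and, for each $1\le i\le s$, $G$ is transitive on the set of $i$-arcs of $\Gamma$. A transitive permutation group is quasiprimitive if all its nontrivial normal subgroups are transitive. A transitive permutation group is biquasiprimitive if it is not quasiprimitive and every nontrivial normal subgroup has at most two orbits. A group acting transitively on a set is called quasiprimitive on that set if the permutation group it induces there is quasiprimitive. For a connected bipartite graph $\Gamma$ and a vertex-transitive $G\le\mathrm{Aut}(\Gamma)$, the even subgroup $G^+$ is the subgroup generated by the vertex stabilisers $G_v$, $v\in V\Gamma$; when $G$ is arc-transitive it has index $2$ in $G$ and its orbits are the two bipartite halves. *)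

theory Defs
  imports
    "HOL-Algebra.Group_Action"
    "HOL-Algebra.Generated_Groups"
    "Graph_Theory.Pair_Digraph"
    "Graph_Theory.Digraph_Component"
    "Graph_Theory.Digraph_Isomorphism"
begin

text \<open>Finite simple undirected graphs are the finite symmetric loop-free digraphs
  of \<^locale>\<open>pair_graph\<close>; an edge is represented by its two orientations.\<close>

definition regular_of_valency :: "'a pair_pre_digraph \<Rightarrow> nat \<Rightarrow> bool" where
  "regular_of_valency \<Gamma> k \<longleftrightarrow> (\<forall>v \<in> pverts \<Gamma>. out_degree (with_proj \<Gamma>) v = k)"

definition bipartition :: "'a pair_pre_digraph \<Rightarrow> 'a set \<Rightarrow> 'a set \<Rightarrow> bool" where
  "bipartition \<Gamma> A B \<longleftrightarrow>
     A \<union> B = pverts \<Gamma> \<and> A \<inter> B = {} \<and>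
     (\<forall>(u, v) \<in> parcs \<Gamma>. (u \<in> A \<and> v \<in> B) \<or> (u \<in> B \<and> v \<in> A))"

definition graph_auto :: "'a pair_pre_digraph \<Rightarrow> ('a \<Rightarrow> 'a) set" where
  "graph_auto \<Gamma> = {f \<in> Bij (pverts \<Gamma>).
     \<forall>u \<in> pverts \<Gamma>. \<forall>v \<in> pverts \<Gamma>. (f u, f v) \<in> parcs \<Gamma> \<longleftrightarrow> (u, v) \<in> parcs \<Gamma>}"

definition GraphAutoGroup :: "'a pair_pre_digraph \<Rightarrow> ('a \<Rightarrow> 'a) monoid" where
  "GraphAutoGroup \<Gamma> = BijGroup (pverts \<Gamma>) \<lparr>carrier := graph_auto \<Gamma>\<rparr>"

definition perm_group :: "'a set \<Rightarrow> ('a \<Rightarrow> 'a) set \<Rightarrow> ('a \<Rightarrow> 'a) monoid" where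
  "perm_group \<Omega> G = BijGroup \<Omega> \<lparr>carrier := G\<rparr>"

definition transitive_perm_group :: "'a set \<Rightarrow> ('a \<Rightarrow> 'a) set \<Rightarrow> bool" where
  "transitive_perm_group \<Omega> G \<longleftrightarrow>
     subgroup G (BijGroup \<Omega>) \<and> transitive_action (perm_group \<Omega> G) \<Omega> (\<lambda>g. g)"

definition nontrivial_normal :: "'a set \<Rightarrow> ('a \<Rightarrow> 'a) set \<Rightarrow> ('a \<Rightarrow> 'a) set \<Rightarrow> bool" where
  "nontrivial_normal \<Omega> G N \<longleftrightarrow> N \<lhd> perm_group \<Omega> G \<and> N \<noteq> {\<one>\<^bsub>perm_group \<Omega> G\<^esub>}"

definition quasiprimitive :: "'a set \<Rightarrow> ('a \<Rightarrow> 'a) set \<Rightarrow> bool" where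
  "quasiprimitive \<Omega> G \<longleftrightarrow>
     transitive_perm_group \<Omega> G \<and>
     (\<forall>N. nontrivial_normal \<Omega> G N \<longrightarrow> transitive_perm_group \<Omega> N)"

definition biquasiprimitive :: "'a set \<Rightarrow> ('a \<Rightarrow> 'a) set \<Rightarrow> bool" where
  "biquasiprimitive \<Omega> G \<longleftrightarrow>
     transitive_perm_group \<Omega> G \<and> \<not> quasiprimitive \<Omega> G \<and>
     (\<forall>N. nontrivial_normal \<Omega> G N \<longrightarrow>
        finite (orbits (perm_group \<Omega> N) \<Omega> (\<lambda>g. g)) \<and>
        card (orbits (perm_group \<Omega> N) \<Omega> (\<lambda>g. g)) \<le> 2)"

text \<open>The permutation group induced on \<open>\<Delta>\<close> by a group \<open>H\<close> of permutations leaving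
  \<open>\<Delta>\<close> invariant; the restriction makes its elements extensional on \<open>\<Delta>\<close>, as
  \<^const>\<open>Bij\<close> requires.\<close>

definition induced_perms :: "'a set \<Rightarrow> ('a \<Rightarrow> 'a) set \<Rightarrow> ('a \<Rightarrow> 'a) set" where
  "induced_perms \<Delta> H = (\<lambda>h. restrict h \<Delta>) ` H"

definition quasiprimitive_on :: "('a \<Rightarrow> 'a) set \<Rightarrow> 'a set \<Rightarrow> bool" where
  "quasiprimitive_on H \<Delta> \<longleftrightarrow> quasiprimitive \<Delta> (induced_perms \<Delta> H)"

text \<open>The \<open>(s+1)\<close>-tuple \<open>(v\<^sub>0, \<dots>, v\<^sub>s)\<close> is represented by a list of length \<open>s + 1\<close>.\<close>

definition s_arcs :: "'a pair_pre_digraph \<Rightarrow> nat \<Rightarrow> 'a list set" where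
  "s_arcs \<Gamma> s = {vs. length vs = s + 1 \<and> set vs \<subseteq> pverts \<Gamma> \<and>
     (\<forall>i. 1 \<le> i \<and> i \<le> s \<longrightarrow> (vs ! (i - 1), vs ! i) \<in> parcs \<Gamma>) \<and>
     (\<forall>j. 1 \<le> j \<and> j + 1 \<le> s \<longrightarrow> vs ! (j - 1) \<noteq> vs ! (j + 1))}"

definition s_arc_transitive :: "'a pair_pre_digraph \<Rightarrow> ('a \<Rightarrow> 'a) set \<Rightarrow> nat \<Rightarrow> bool" where
  "s_arc_transitive \<Gamma> G s \<longleftrightarrow>
     s_arcs \<Gamma> s \<noteq> {} \<and>
     (\<forall>i. 1 \<le> i \<and> i \<le> s \<longrightarrow>
        transitive_action (perm_group (pverts \<Gamma>) G) (s_arcs \<Gamma> i)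
          (\<lambda>g. \<lambda>vs \<in> s_arcs \<Gamma> i. map g vs))"

definition even_subgroup :: "'a pair_pre_digraph \<Rightarrow> ('a \<Rightarrow> 'a) set \<Rightarrow> ('a \<Rightarrow> 'a) set" where
  "even_subgroup \<Gamma> G =
     generate (perm_group (pverts \<Gamma>) G)
       (\<Union>v \<in> pverts \<Gamma>. stabilizer (perm_group (pverts \<Gamma>) G) (\<lambda>g. g) v)"

end

theory Submission
  imports Defs "HOL-Number_Theory.Cong"
begin

text \<open>Let \<open>T\<close> be a finite nonabelian simple group generated by two elements \<open>a\<close>, \<open>b\<close> of order
  three, and let \<open>t\<close> be an involution of \<open>T\<close> inverting both. In the wreath product of \<open>T\<close> with the
  group of order two, whose elements are the triples \<open>(x, y, e)\<close> with \<open>e\<close> telling whether the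
  coordinates are swapped, put \<open>L = \<langle>(a, b), (t, t)\<rangle>\<close>, a copy of the symmetric group on three
  letters, and \<open>\<tau> = (1, t)\<close> followed by the swap, so that \<open>\<tau>\<^sup>2 = (t, t)\<close> and \<open>\<tau>\<close> conjugates
  \<open>(x, y)\<close> to \<open>(y, t x t)\<close>. The coset graph of \<open>L\<close> and \<open>\<tau>\<close> is cubic and 2-arc transitive, with
  even subgroup \<open>T \<times> T\<close>. This is the unique minimal normal subgroup of the wreath product and has
  two orbits on the vertices, whereas its normal subgroup \<open>T \<times> 1\<close> is intransitive on both halves.

  The graph is connected as soon as no automorphism of \<open>T\<close> sends \<open>a\<close> to \<open>b\<close> and \<open>b\<close> to \<open>a\<^sup>-\<^sup>1\<close>,
  since a subdirect subgroup of \<open>T \<times> T\<close> that is not the graph of an automorphism is everything.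
  For \<open>T = PSL(2, p)\<close> with \<open>p > 11\<close> dividing \<open>i\<^sup>2 + 1\<close>, take \<open>a\<close> and \<open>b\<close> to be the generators of
  order three of the subgroup of index two in the modular group and \<open>t\<close> to be \<open>i\<close> times the matrix of
  the coordinate swap: \<open>a b\<close> is unipotent, hence conjugate to its fourth power, but the traces of
  \<open>b a\<^sup>-\<^sup>1\<close> and its fourth power are \<open>3\<close> and \<open>47\<close>.\<close>

section \<open>Permutation groups\<close>

lemma carrier_perm_group [simp]: "carrier (perm_group \<Omega> P) = P"
  by (simp add: perm_group_def)

lemma one_perm_group: "\<one>\<^bsub>perm_group \<Omega> P\<^esub> = (\<lambda>x\<in>\<Omega>. x)"
  by (simp add: perm_group_def BijGroup_def)

lemma mult_perm_group: "x \<otimes>\<^bsub>perm_group \<Omega> P\<^esub> y = x \<otimes>\<^bsub>BijGroup \<Omega>\<^esub> y"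
  by (simp add: perm_group_def)

lemma BijGroup_mult_apply:
  assumes "f \<in> Bij \<Omega>" "g \<in> Bij \<Omega>" "x \<in> \<Omega>"
  shows "(f \<otimes>\<^bsub>BijGroup \<Omega>\<^esub> g) x = f (g x)"
  using assms by (simp add: BijGroup_def compose_eq)

lemma carrier_BijGroup [simp]: "carrier (BijGroup \<Omega>) = Bij \<Omega>"
  by (simp add: BijGroup_def)

lemma group_hom_perm_group_image:
  assumes "group_hom X (BijGroup \<Omega>) \<rho>"
  shows "group_hom X (perm_group \<Omega> (\<rho> ` carrier X)) \<rho>"
proof -
  interpret group_hom X "BijGroup \<Omega>" \<rho> by fact
  have sub: "subgroup (\<rho> ` carrier X) (BijGroup \<Omega>)"
    using img_is_subgroup .
  have "group (perm_group \<Omega> (\<rho> ` carrier X))"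
    unfolding perm_group_def using sub H.subgroup_imp_group by blast
  moreover have "\<rho> \<in> hom X (perm_group \<Omega> (\<rho> ` carrier X))"
    using homh by (auto simp: hom_def mult_perm_group)
  ultimately show ?thesis
    by (simp add: group_hom_def group_hom_axioms_def)
qed

lemma transitive_perm_group_iff:
  "transitive_perm_group \<Omega> P \<longleftrightarrow>
     subgroup P (BijGroup \<Omega>) \<and> (\<forall>x\<in>\<Omega>. \<forall>y\<in>\<Omega>. \<exists>g\<in>P. g x = y)"
proof -
  have "transitive_action (perm_group \<Omega> P) \<Omega> (\<lambda>g. g)"
    if P: "subgroup P (BijGroup \<Omega>)" and tr: "\<forall>x\<in>\<Omega>. \<forall>y\<in>\<Omega>. \<exists>g\<in>P. g x = y"
  proof -
    have "group (perm_group \<Omega> P)"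
      unfolding perm_group_def using P group_BijGroup group.subgroup_imp_group by blast
    moreover have "(\<lambda>g. g) \<in> hom (perm_group \<Omega> P) (BijGroup \<Omega>)"
      using subgroup.subset[OF P] by (auto simp: hom_def mult_perm_group)
    ultimately have "group_hom (perm_group \<Omega> P) (BijGroup \<Omega>) (\<lambda>g. g)"
      by (simp add: group_hom_def group_hom_axioms_def group_BijGroup)
    then show ?thesis
      using tr by (simp add: transitive_action_def group_action_def transitive_action_axioms_def)
  qed
  moreover have "\<forall>x\<in>\<Omega>. \<forall>y\<in>\<Omega>. \<exists>g\<in>P. g x = y"
    if "transitive_action (perm_group \<Omega> P) \<Omega> (\<lambda>g. g)"
    using transitive_action.unique_orbit[OF that] by simp
  ultimately show ?thesis
    by (auto simp: transitive_perm_group_def)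
qed

section \<open>Automorphisms of a graph and their action on s-arcs\<close>

lemma graph_auto_subset_Bij: "graph_auto \<Gamma> \<subseteq> Bij (pverts \<Gamma>)"
  by (auto simp: graph_auto_def)

lemma subgroup_graph_auto: "subgroup (graph_auto \<Gamma>) (BijGroup (pverts \<Gamma>))"
proof -
  let ?V = "pverts \<Gamma>"
  interpret B: group "BijGroup ?V" by (rule group_BijGroup)
  show ?thesis
  proof (rule B.subgroupI)
    show "graph_auto \<Gamma> \<subseteq> carrier (BijGroup ?V)"
      using graph_auto_subset_Bij by simp
    have "(\<lambda>x\<in>?V. x) \<in> graph_auto \<Gamma>"
      by (simp add: graph_auto_def id_Bij)
    then show "graph_auto \<Gamma> \<noteq> {}" by blast
  next
    fix f assume f: "f \<in> graph_auto \<Gamma>"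
    then have fB: "f \<in> Bij ?V" using graph_auto_subset_Bij by blast
    have bij: "bij_betw f ?V ?V" using fB by (simp add: Bij_def)
    have inv: "inv_into ?V f x \<in> ?V" "f (inv_into ?V f x) = x" if "x \<in> ?V" for x
      using bij that by (auto simp: bij_betw_def inv_into_into f_inv_into_f)
    show "inv\<^bsub>BijGroup ?V\<^esub> f \<in> graph_auto \<Gamma>"
      unfolding inv_BijGroup[OF fB]
      using f inv restrict_inv_into_Bij[OF fB] unfolding graph_auto_def
      by (smt (verit) mem_Collect_eq restrict_apply')
  next
    fix f g assume fg: "f \<in> graph_auto \<Gamma>" "g \<in> graph_auto \<Gamma>"
    then have B: "f \<in> Bij ?V" "g \<in> Bij ?V" using graph_auto_subset_Bij by blast+
    have "g x \<in> ?V" if "x \<in> ?V" for x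
      using B(2) that Bij_imp_funcset by blast
    then show "f \<otimes>\<^bsub>BijGroup ?V\<^esub> g \<in> graph_auto \<Gamma>"
      using fg B compose_Bij[OF B] by (simp add: graph_auto_def BijGroup_mult_apply)
        (simp add: BijGroup_def)
  qed
qed

lemma subgroup_GraphAutoGroup_iff:
  "subgroup P (GraphAutoGroup \<Gamma>) \<longleftrightarrow> subgroup P (BijGroup (pverts \<Gamma>)) \<and> P \<subseteq> graph_auto \<Gamma>"
proof -
  interpret B: group "BijGroup (pverts \<Gamma>)" by (rule group_BijGroup)
  show ?thesis
    unfolding GraphAutoGroup_def
    using B.subgroup_incl[OF _ subgroup_graph_auto] B.incl_subgroup[OF subgroup_graph_auto]
      subgroup.subset[of P "BijGroup (pverts \<Gamma>)\<lparr>carrier := graph_auto \<Gamma>\<rparr>"]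
    by auto
qed

text \<open>Leaves only pointwise transitivity to check. Automorphisms preserve arcs and, being
  injective, the condition against backtracking; inverses make \<open>map g\<close> a bijection of
  the s-arcs.\<close>

lemma transitive_action_s_arcs:
  assumes P: "subgroup P (GraphAutoGroup \<Gamma>)"
    and tr: "\<And>xs ys. xs \<in> s_arcs \<Gamma> i \<Longrightarrow> ys \<in> s_arcs \<Gamma> i \<Longrightarrow> \<exists>g\<in>P. map g xs = ys"
  shows "transitive_action (perm_group (pverts \<Gamma>) P) (s_arcs \<Gamma> i)
          (\<lambda>g. \<lambda>vs \<in> s_arcs \<Gamma> i. map g vs)"
proof -
  let ?V = "pverts \<Gamma>" and ?S = "s_arcs \<Gamma> i"
  let ?\<phi> = "\<lambda>g. \<lambda>vs \<in> ?S. map g vs"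
  have PB: "subgroup P (BijGroup ?V)" and PA: "P \<subseteq> graph_auto \<Gamma>"
    using P by (auto simp: subgroup_GraphAutoGroup_iff)
  have PBij: "P \<subseteq> Bij ?V" using PA graph_auto_subset_Bij by blast
  interpret B: group "BijGroup ?V" by (rule group_BijGroup)
  have closed: "map g vs \<in> ?S" if "g \<in> P" "vs \<in> ?S" for g vs
  proof -
    have g: "g \<in> graph_auto \<Gamma>" using that PA by blast
    then have inj: "inj_on g ?V" and im: "g ` ?V = ?V"
      by (auto simp: graph_auto_def Bij_def bij_betw_def)
    have len: "length vs = i + 1" and sub: "set vs \<subseteq> ?V"
      using that(2) by (auto simp: s_arcs_def)
    have nth: "vs ! j \<in> ?V" if "j \<le> i" for j
      using len sub that by (simp add: subset_iff)
    show ?thesis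
      unfolding s_arcs_def
    proof (intro CollectI conjI allI impI)
      show "set (map g vs) \<subseteq> ?V" using im sub by auto
    next
      fix j assume j: "1 \<le> j \<and> j \<le> i"
      then have "(vs ! (j - 1), vs ! j) \<in> parcs \<Gamma>"
        using that(2) by (simp add: s_arcs_def)
      then show "(map g vs ! (j - 1), map g vs ! j) \<in> parcs \<Gamma>"
        using g nth[of j] nth[of "j - 1"] j len by (auto simp: graph_auto_def)
    next
      fix j assume j: "1 \<le> j \<and> j + 1 \<le> i"
      then have "vs ! (j - 1) \<noteq> vs ! (j + 1)"
        using that(2) by (simp add: s_arcs_def)
      then have "g (vs ! (j - 1)) \<noteq> g (vs ! (j + 1))"
        using nth[of "j + 1"] nth[of "j - 1"] j inj by (auto simp: inj_on_eq_iff)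
      then show "map g vs ! (j - 1) \<noteq> map g vs ! (j + 1)"
        using j len by (auto simp: nth_map)
    qed (use len in simp)
  qed
  have comp: "map g (map h vs) = map (g \<otimes>\<^bsub>BijGroup ?V\<^esub> h) vs"
    if "g \<in> P" "h \<in> P" "vs \<in> ?S" for g h vs
  proof -
    have "set vs \<subseteq> ?V" using that by (simp add: s_arcs_def)
    then show ?thesis
      using that PBij by (auto simp: BijGroup_mult_apply subset_iff)
  qed
  have one: "map (\<one>\<^bsub>BijGroup ?V\<^esub>) vs = vs" if "vs \<in> ?S" for vs
    using that by (auto simp: s_arcs_def BijGroup_def subset_iff intro!: map_idI)
  have bij: "?\<phi> g \<in> Bij ?S" if g: "g \<in> P" for g
  proof -
    let ?g' = "inv\<^bsub>BijGroup ?V\<^esub> g"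
    have g': "?g' \<in> P" using PB g by (rule subgroup.m_inv_closed)
    have gB: "g \<in> carrier (BijGroup ?V)" using g PBij by auto
    have "bij_betw (map g) ?S ?S"
    proof (rule bij_betw_byWitness[where f' = "map ?g'"])
      show "\<forall>vs\<in>?S. map ?g' (map g vs) = vs"
        using g g' gB one by (simp add: comp del: map_map)
      show "\<forall>vs\<in>?S. map g (map ?g' vs) = vs"
        using g g' gB one by (simp add: comp del: map_map)
    qed (use g g' closed in auto)
    then show ?thesis
      by (simp add: Bij_def)
  qed
  have "?\<phi> \<in> hom (perm_group ?V P) (BijGroup ?S)"
  proof (rule homI)
    fix g h assume gh: "g \<in> carrier (perm_group ?V P)" "h \<in> carrier (perm_group ?V P)"
    then have "g \<in> P" "h \<in> P" by simp_all
    then have "?\<phi> (g \<otimes>\<^bsub>BijGroup ?V\<^esub> h) = compose ?S (?\<phi> g) (?\<phi> h)"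
      by (auto simp: compose_def fun_eq_iff comp[symmetric] closed simp del: map_map)
    then show "?\<phi> (g \<otimes>\<^bsub>perm_group ?V P\<^esub> h) = ?\<phi> g \<otimes>\<^bsub>BijGroup ?S\<^esub> ?\<phi> h"
      using gh bij by (simp add: BijGroup_def mult_perm_group)
  qed (use bij in auto)
  moreover have "group (perm_group ?V P)"
    unfolding perm_group_def using PB B.subgroup_imp_group by blast
  ultimately have "group_hom (perm_group ?V P) (BijGroup ?S) ?\<phi>"
    by (simp add: group_hom_def group_hom_axioms_def group_BijGroup)
  then show ?thesis
    using tr by (simp add: transitive_action_def group_action_def transitive_action_axioms_def)
qed

section \<open>Coset graphs\<close>

text \<open>The vertex \<open>v g\<close> is a name for the left coset of \<open>L\<close>
  containing \<open>g\<close>. Only the equality criterion for names is assumed, so that vertices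
  can be natural numbers.\<close>

locale coset_action = group G for G :: "('g, 'm) monoid_scheme" (structure) +
  fixes L :: "'g set" and v :: "'g \<Rightarrow> 'v"
  assumes finite_carrier: "finite (carrier G)"
    and L: "subgroup L G"
    and v_eq_iff: "\<And>g h. g \<in> carrier G \<Longrightarrow> h \<in> carrier G \<Longrightarrow> v g = v h \<longleftrightarrow> inv g \<otimes> h \<in> L"
begin

definition V where "V = v ` carrier G"

definition act where
  "act g = (\<lambda>x\<in>V. v (g \<otimes> (SOME h. h \<in> carrier G \<and> v h = x)))"

lemma v_in_V [simp]: "g \<in> carrier G \<Longrightarrow> v g \<in> V"
  by (simp add: V_def)

lemma V_cases: "x \<in> V \<Longrightarrow> (\<And>g. g \<in> carrier G \<Longrightarrow> x = v g \<Longrightarrow> thesis) \<Longrightarrow> thesis"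
  by (auto simp: V_def)

lemma L_carrier: "l \<in> L \<Longrightarrow> l \<in> carrier G"
  using subgroup.mem_carrier[OF L] .

lemma v_mult_L [simp]: "g \<in> carrier G \<Longrightarrow> l \<in> L \<Longrightarrow> v (g \<otimes> l) = v g"
  by (subst eq_commute, subst v_eq_iff) (simp_all add: L_carrier m_assoc[symmetric])

lemma v_eq_obtain:
  assumes "g \<in> carrier G" "h \<in> carrier G" "v g = v h"
  obtains l where "l \<in> L" "h = g \<otimes> l"
proof
  show "inv g \<otimes> h \<in> L" using assms v_eq_iff by simp
  show "h = g \<otimes> (inv g \<otimes> h)" using assms by (simp add: m_assoc[symmetric])
qed

lemma v_mult_left:
  assumes "g \<in> carrier G" "h \<in> carrier G" "k \<in> carrier G"
  shows "v (g \<otimes> h) = v (g \<otimes> k) \<longleftrightarrow> v h = v k"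
proof -
  have "inv g \<otimes> (g \<otimes> k) = k"
    using assms by (simp add: m_assoc[symmetric])
  then have "inv (g \<otimes> h) \<otimes> (g \<otimes> k) = inv h \<otimes> k"
    using assms by (simp add: inv_mult_group m_assoc)
  then show ?thesis
    using assms by (simp add: v_eq_iff)
qed

lemma act_v [simp]:
  assumes "g \<in> carrier G" "h \<in> carrier G"
  shows "act g (v h) = v (g \<otimes> h)"
proof -
  let ?k = "SOME k. k \<in> carrier G \<and> v k = v h"
  have "?k \<in> carrier G \<and> v ?k = v h"
    by (rule someI) (use assms in simp)
  then show ?thesis
    using assms by (simp add: act_def v_mult_left)
qed

lemma act_Bij: assumes g: "g \<in> carrier G" shows "act g \<in> Bij V"
proof -
  have "bij_betw (act g) V V"
    by (rule bij_betw_byWitness[where f' = "act (inv g)"])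
      (use g in \<open>auto simp: V_def m_assoc[symmetric]\<close>)
  then show ?thesis
    by (simp add: Bij_def act_def)
qed

lemma act_hom: "group_hom G (BijGroup V) act"
proof -
  have "act \<in> hom G (BijGroup V)"
  proof (rule homI)
    fix g h assume gh: "g \<in> carrier G" "h \<in> carrier G"
    have "act (g \<otimes> h) = compose V (act g) (act h)"
    proof (rule extensionalityI[of _ V])
      fix x assume "x \<in> V"
      then show "act (g \<otimes> h) x = compose V (act g) (act h) x"
        using gh by (auto simp: V_def compose_eq m_assoc)
    qed (use gh in \<open>auto simp: act_def compose_def\<close>)
    then show "act (g \<otimes> h) = act g \<otimes>\<^bsub>BijGroup V\<^esub> act h"
      using gh act_Bij by (simp add: BijGroup_def)
  qed (simp add: act_Bij)
  then show ?thesis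
    by (simp add: group_hom_def group_hom_axioms_def group_BijGroup is_group)
qed

definition P where "P = act ` carrier G"

sublocale act: group_hom G "perm_group V P" act
  unfolding P_def using group_hom_perm_group_image[OF act_hom] .

declare act.hom_mult [simp del] act.hom_inv [simp del]

lemma subgroup_P: "subgroup P (BijGroup V)"
  unfolding P_def using group_hom.img_is_subgroup[OF act_hom] .

lemma transitive_P: "transitive_perm_group V P"
proof -
  have "\<exists>f\<in>P. f (v g) = v h" if "g \<in> carrier G" "h \<in> carrier G" for g h
    using that by (intro bexI[of _ "act (h \<otimes> inv g)"]) (auto simp: P_def m_assoc)
  then show ?thesis
    using subgroup_P by (auto simp: transitive_perm_group_iff V_def)
qed

lemma act_eq_one_imp: "g \<in> carrier G \<Longrightarrow> h \<in> carrier G \<Longrightarrow> act g = \<one>\<^bsub>perm_group V P\<^esub> \<Longrightarrow> v (g \<otimes> h) = v h"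
  using act_v[of g h] by (simp add: one_perm_group del: act_v)

text \<open>Carries normal subgroups of the permutation group back to \<open>G\<close>, where the
  assumptions on normal subgroups are made.\<close>

lemma normal_preimage:
  assumes N: "N \<lhd> perm_group V P"
  shows "{g \<in> carrier G. act g \<in> N} \<lhd> G"
proof -
  have sub: "subgroup N (perm_group V P)"
    using N by (rule normal_imp_subgroup)
  show ?thesis
    unfolding normal_inv_iff
  proof (intro conjI ballI)
    show "subgroup {g \<in> carrier G. act g \<in> N} G"
      by (rule subgroupI)
        (use sub subgroup.one_closed[OF sub] subgroup.m_inv_closed[OF sub] subgroup.m_closed[OF sub]
          in \<open>auto simp: act.hom_inv act.hom_one[symmetric] act.hom_mult simp del: act.hom_one\<close>)
  next
    fix x h assume "x \<in> carrier G" "h \<in> {g \<in> carrier G. act g \<in> N}"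
    then show "x \<otimes> h \<otimes> inv x \<in> {g \<in> carrier G. act g \<in> N}"
      using normal.inv_op_closed2[OF N, of "act x" "act h"] act.hom_closed
      by (simp add: act.hom_mult act.hom_inv)
  qed
qed

end

text \<open>\<open>H\<close> models the base group \<open>T \<times> T\<close> of the wreath
  product, and \<open>\<tau>\<close> exchanges the two halves; \<open>G\<close> is the union of
  \<open>H\<close> and \<open>H \<tau>\<close>. That \<open>H\<close> lies in every nontrivial
  normal subgroup is what bounds the number of orbits by two.\<close>

locale index_two_coset_action = coset_action +
  fixes H :: "'a set" and \<tau> :: 'a
  assumes H: "H \<lhd> G" and L_H: "L \<subseteq> H"
    and tau [simp]: "\<tau> \<in> carrier G" and tau_H: "\<tau> \<notin> H"
    and index_two: "\<And>g. g \<in> carrier G \<Longrightarrow> g \<notin> H \<Longrightarrow> g \<otimes> inv \<tau> \<in> H"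
    and tau_sq: "\<tau> \<otimes> \<tau> \<in> L"
    and normal_contains_H: "\<And>N. N \<lhd> G \<Longrightarrow> N \<noteq> {\<one>} \<Longrightarrow> H \<subseteq> N"
    and L_neq_H: "L \<noteq> H"
begin

lemma subgroup_H: "subgroup H G"
  using H by (rule normal_imp_subgroup)

lemma H_carrier [simp]: "h \<in> H \<Longrightarrow> h \<in> carrier G"
  using subgroup.mem_carrier[OF subgroup_H] .

lemma carrier_cases:
  assumes "g \<in> carrier G"
  obtains "g \<in> H" | h where "h \<in> H" "g = h \<otimes> \<tau>"
proof (cases "g \<in> H")
  case False
  then have "g \<otimes> inv \<tau> \<in> H" "g = g \<otimes> inv \<tau> \<otimes> \<tau>"
    using assms index_two by (auto simp: m_assoc)
  then show ?thesis using that by blast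
qed (use that in blast)

lemma mult_tau_notin_H: "h \<in> H \<Longrightarrow> h \<otimes> \<tau> \<notin> H"
  using tau_H subgroup.m_closed[OF subgroup_H] subgroup.m_inv_closed[OF subgroup_H]
  by (metis H_carrier inv_closed inv_solve_left tau)

lemma v_tau_notin:
  assumes "h \<in> H" "k \<in> H" shows "v h \<noteq> v (k \<otimes> \<tau>)"
proof
  assume "v h = v (k \<otimes> \<tau>)"
  then obtain l where "l \<in> L" "k \<otimes> \<tau> = h \<otimes> l"
    using assms v_eq_obtain[of h "k \<otimes> \<tau>"] by auto
  then have "k \<otimes> \<tau> \<in> H"
    using assms L_H subgroup.m_closed[OF subgroup_H] by auto
  then show False
    using assms mult_tau_notin_H by blast
qed

text \<open>A non-identity element of \<open>N\<close> is \<open>act g\<close> with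
  \<open>g \<noteq> \<one>\<close>, so the preimage of \<open>N\<close> in \<open>G\<close> is
  nontrivial and contains \<open>H\<close>.\<close>

lemma normal_contains_act_H:
  assumes "nontrivial_normal V P N"
  shows "act ` H \<subseteq> N"
proof -
  let ?N = "{g \<in> carrier G. act g \<in> N}"
  have N: "N \<lhd> perm_group V P" "N \<noteq> {\<one>\<^bsub>perm_group V P\<^esub>}"
    using assms by (auto simp: nontrivial_normal_def)
  have sub: "subgroup N (perm_group V P)"
    using N(1) by (rule normal_imp_subgroup)
  then obtain n where n: "n \<in> N" "n \<noteq> \<one>\<^bsub>perm_group V P\<^esub>"
    using N(2) subgroup.one_closed by blast
  then obtain g where g: "g \<in> carrier G" "n = act g"
    using subgroup.mem_carrier[OF sub n(1)] by (auto simp: P_def)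
  then have "g \<noteq> \<one>"
    using n act.hom_one by blast
  then have "?N \<noteq> {\<one>}"
    using g n by blast
  then have "H \<subseteq> ?N"
    using normal_contains_H normal_preimage[OF N(1)] by blast
  then show ?thesis by blast
qed

text \<open>Left factors from \<open>H\<close> can be absorbed into \<open>N\<close>, which contains
  their images. By \<open>carrier_cases\<close> this reduces every \<open>g\<close> to
  \<open>\<one>\<close> or \<open>\<tau>\<close>.\<close>

lemma orbit_subset_halves:
  assumes N: "nontrivial_normal V P N" and g: "g \<in> carrier G"
  shows "orbit (perm_group V N) (\<lambda>f. f) (v g) \<in> (\<lambda>g. {f (v g) |f. f \<in> N}) ` {\<one>, \<tau>}"
proof -
  have sub: "subgroup N (perm_group V P)"
    using N by (auto simp: nontrivial_normal_def normal_imp_subgroup)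
  have NP: "f \<in> P" if "f \<in> N" for f
    using subgroup.mem_carrier[OF sub that] by simp
  have shift: "{f (v (h \<otimes> x)) |f. f \<in> N} = {f (v x) |f. f \<in> N}" if h: "h \<in> H" and x: "x \<in> carrier G" for h x
  proof -
    have hN: "act h \<in> N" "act (inv h) \<in> N"
      using normal_contains_act_H[OF N] h subgroup.m_inv_closed[OF subgroup_H] by auto
    have prod: "\<exists>f'\<in>N. \<forall>y\<in>V. f' y = f (k y)" if "f \<in> N" "k \<in> N" for f k
    proof (intro bexI ballI)
      show "f \<otimes>\<^bsub>BijGroup V\<^esub> k \<in> N"
        using subgroup.m_closed[OF sub that] by (simp add: mult_perm_group)
      show "(f \<otimes>\<^bsub>BijGroup V\<^esub> k) y = f (k y)" if "y \<in> V" for y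
        using NP \<open>f \<in> N\<close> \<open>k \<in> N\<close> that subgroup.subset[OF subgroup_P]
        by (intro BijGroup_mult_apply) auto
    qed
    show ?thesis
    proof (intro equalityI subsetI; clarify)
      fix f assume "f \<in> N"
      from prod[OF this hN(1)] obtain f' where "f' \<in> N" "\<forall>y\<in>V. f' y = f (act h y)"
        by blast
      then show "\<exists>f'. f (v (h \<otimes> x)) = f' (v x) \<and> f' \<in> N"
        using h x by (intro exI[of _ f']) simp
    next
      fix f assume "f \<in> N"
      from prod[OF this hN(2)] obtain f' where "f' \<in> N" "\<forall>y\<in>V. f' y = f (act (inv h) y)"
        by blast
      moreover have "act (inv h) (v (h \<otimes> x)) = v x"
        using h x by (simp add: m_assoc[symmetric])
      ultimately show "\<exists>f'. f (v x) = f' (v (h \<otimes> x)) \<and> f' \<in> N"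
        using h x by (metis H_carrier m_closed v_in_V)
    qed
  qed
  have "\<exists>y\<in>{\<one>, \<tau>}. {f (v g) |f. f \<in> N} = {f (v y) |f. f \<in> N}"
  proof (cases rule: carrier_cases[OF g])
    case 1
    then show ?thesis
      using shift[of g \<one>] by simp
  next
    case (2 h)
    then show ?thesis
      using shift[of h \<tau>] by simp
  qed
  then show ?thesis
    by (auto simp: orbit_def)
qed

lemma nontrivial_normal_act_H: "nontrivial_normal V P (act ` H)"
proof -
  have "act ` H \<lhd> perm_group V P"
    using normal.surj_hom_normal_subgroup[OF H act.group_hom_axioms] by (simp add: P_def)
  moreover obtain h where h: "h \<in> H" "h \<notin> L"
    using L_neq_H L_H by blast
  have "act h \<noteq> \<one>\<^bsub>perm_group V P\<^esub>"
  proof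
    assume "act h = \<one>\<^bsub>perm_group V P\<^esub>"
    then have "v \<one> = v h"
      using h act_eq_one_imp[of h \<one>] by simp
    then show False
      using h v_eq_iff[of \<one> h] by simp
  qed
  ultimately show ?thesis
    using h by (auto simp: nontrivial_normal_def)
qed

text \<open>The image of \<open>H\<close> is itself a nontrivial normal subgroup and never carries
  \<open>v \<one>\<close> to \<open>v \<tau>\<close>, so quasiprimitivity fails.\<close>

lemma biquasiprimitive_P: "biquasiprimitive V P"
  unfolding biquasiprimitive_def
proof (intro conjI allI impI)
  have "\<not> transitive_perm_group V (act ` H)"
  proof
    assume "transitive_perm_group V (act ` H)"
    then have "\<exists>f\<in>act ` H. f (v \<one>) = v \<tau>"
      using v_in_V[OF one_closed] v_in_V[OF tau] by (simp only: transitive_perm_group_iff)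
    then show False
      using v_tau_notin[OF _ subgroup.one_closed[OF subgroup_H]] by auto
  qed
  then show "\<not> quasiprimitive V P"
    using nontrivial_normal_act_H by (auto simp: quasiprimitive_def)
next
  fix N assume N: "nontrivial_normal V P N"
  let ?O = "(\<lambda>g. {f (v g) |f. f \<in> N}) ` {\<one>, \<tau>}"
  have sub: "orbits (perm_group V N) V (\<lambda>f. f) \<subseteq> ?O"
    using orbit_subset_halves[OF N] by (auto simp: orbits_def V_def)
  then show "finite (orbits (perm_group V N) V (\<lambda>g. g))"
    by (rule finite_subset) simp
  have "card (orbits (perm_group V N) V (\<lambda>g. g)) \<le> card ?O"
    by (rule card_mono[OF _ sub]) simp
  also have "\<dots> \<le> card {\<one>, \<tau>}"
    by (rule card_image_le) simp
  also have "\<dots> \<le> 2"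
    by (simp add: card_insert_if)
  finally show "card (orbits (perm_group V N) V (\<lambda>g. g)) \<le> 2" .
qed (rule transitive_P)

section \<open>The bipartite halves as orbits of \<open>H\<close>\<close>

definition half where "half x = (\<lambda>h. v (h \<otimes> x)) ` H"

text \<open>The image of \<open>K\<close> is normal in the group induced by \<open>H\<close> on the
  half. It is nontrivial, since some \<open>k\<close> moves \<open>v x\<close>, and intransitive,
  since it never takes \<open>v x\<close> to \<open>v (h \<otimes> x)\<close>.\<close>

lemma half_not_quasiprimitive:
  assumes x: "x \<in> carrier G"
    and K: "K \<lhd> G\<lparr>carrier := H\<rparr>"
    and moved: "k \<in> K" "v (k \<otimes> x) \<noteq> v x"
    and intransitive: "h \<in> H" "\<And>k. k \<in> K \<Longrightarrow> v (k \<otimes> x) \<noteq> v (h \<otimes> x)"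
  shows "\<not> quasiprimitive_on (act ` H) (half x)"
proof
  assume q: "quasiprimitive_on (act ` H) (half x)"
  let ?A = "half x" and ?H = "G\<lparr>carrier := H\<rparr>"
  \<comment> \<open>This presents the induced group as the image of \<open>H\<close> under one
    homomorphism, so that normality of \<open>K\<close> passes to its image.\<close>
  let ?\<rho> = "\<lambda>h. restrict (act h) ?A"
  have AV: "?A \<subseteq> V" using x by (auto simp: half_def V_def)
  have KH: "k \<in> H" if "k \<in> K" for k
    using subgroup.mem_carrier[OF normal_imp_subgroup[OF K] that] by simp
  have one_H: "\<one> \<in> H" using subgroup.one_closed[OF subgroup_H] .
  have closed: "act h y \<in> ?A" if "h \<in> H" "y \<in> ?A" for h y
    using that x subgroup.m_closed[OF subgroup_H]
    by (auto simp: half_def m_assoc[symmetric])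
  have invact: "act (inv h) (act h y) = y" "act h (act (inv h) y) = y" if "h \<in> H" "y \<in> ?A" for h y
    using that x by (auto simp: half_def m_assoc[symmetric])
  have Bij: "?\<rho> h \<in> Bij ?A" if "h \<in> H" for h
  proof -
    have "bij_betw (act h) ?A ?A"
      by (rule bij_betw_byWitness[where f' = "act (inv h)"])
        (use that invact closed subgroup.m_inv_closed[OF subgroup_H] in auto)
    then show ?thesis by (simp add: Bij_def)
  qed
  have "group ?H" using subgroup_imp_group[OF subgroup_H] .
  moreover have "?\<rho> \<in> hom ?H (BijGroup ?A)"
  proof (rule homI)
    fix g h assume "g \<in> carrier ?H" "h \<in> carrier ?H"
    then have gh: "g \<in> H" "h \<in> H" by simp_all
    have "?\<rho> (g \<otimes> h) = compose ?A (?\<rho> g) (?\<rho> h)"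
      by (rule extensionalityI[of _ ?A])
        (use gh x closed in \<open>auto simp: compose_def, auto simp: half_def m_assoc\<close>)
    then show "?\<rho> (g \<otimes>\<^bsub>?H\<^esub> h) = ?\<rho> g \<otimes>\<^bsub>BijGroup ?A\<^esub> ?\<rho> h"
      using gh Bij by (simp add: BijGroup_def)
  qed (use Bij in auto)
  ultimately have "group_hom ?H (BijGroup ?A) ?\<rho>"
    by (simp add: group_hom_def group_hom_axioms_def group_BijGroup)
  then have "group_hom ?H (perm_group ?A (?\<rho> ` carrier ?H)) ?\<rho>"
    by (rule group_hom_perm_group_image)
  then have "?\<rho> ` K \<lhd> perm_group ?A (?\<rho> ` carrier ?H)"
    by (rule normal.surj_hom_normal_subgroup[OF K]) simp
  then have "?\<rho> ` K \<lhd> perm_group ?A (?\<rho> ` H)"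
    by simp
  moreover have xA: "v x \<in> ?A"
    using one_H x by (force simp: half_def)
  have "?\<rho> k (v x) \<noteq> v x"
    using moved KH xA x by simp
  then have "?\<rho> ` K \<noteq> {\<one>\<^bsub>perm_group ?A (?\<rho> ` H)\<^esub>}"
  proof -
    assume *: "?\<rho> k (v x) \<noteq> v x"
    have "\<one>\<^bsub>perm_group ?A (?\<rho> ` H)\<^esub> (v x) = v x"
      unfolding one_perm_group using xA by (rule restrict_apply')
    then have "?\<rho> k \<noteq> \<one>\<^bsub>perm_group ?A (?\<rho> ` H)\<^esub>"
      using * by metis
    then show ?thesis
      using moved(1) by blast
  qed
  ultimately have "nontrivial_normal ?A (?\<rho> ` H) (?\<rho> ` K)"
    by (simp add: nontrivial_normal_def)
  then have "transitive_perm_group ?A (?\<rho> ` K)"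
    using q by (simp add: quasiprimitive_on_def quasiprimitive_def induced_perms_def image_image)
  moreover have "v (h \<otimes> x) \<in> ?A"
    using intransitive(1) by (auto simp: half_def)
  ultimately have "\<exists>f\<in>?\<rho> ` K. f (v x) = v (h \<otimes> x)"
    using xA unfolding transitive_perm_group_iff by blast
  then obtain k' where k': "k' \<in> K" "?\<rho> k' (v x) = v (h \<otimes> x)"
    by blast
  then show False
    using intransitive(2)[OF k'(1)] xA x KH by simp
qed

end

text \<open>\<open>L\<close> has the form of the symmetric group on three letters, with rotation
  \<open>a\<close> and reflection \<open>t\<close>. The neighbours of \<open>v \<one>\<close> are
  the \<open>L\<close>-images of \<open>v \<tau>\<close>; the reflection fixes
  \<open>v \<tau>\<close> by \<open>t_tau\<close> and the rotation moves it by \<open>a_tau\<close>,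
  whence valency three.\<close>

locale cubic_coset_graph = index_two_coset_action +
  fixes a t :: 'a
  assumes a_cube: "a \<otimes> a \<otimes> a = \<one>"
    and t_a: "t \<otimes> a = a \<otimes> a \<otimes> t"
    and L_eq: "L = {\<one>, a, a \<otimes> a, t, a \<otimes> t, a \<otimes> a \<otimes> t}"
    and t_tau: "inv \<tau> \<otimes> t \<otimes> \<tau> \<in> L"
    and a_tau: "inv \<tau> \<otimes> a \<otimes> \<tau> \<notin> L"
    and generated: "generate G (insert \<tau> L) = carrier G"
begin

lemma a_L: "a \<in> L" and aa_L: "a \<otimes> a \<in> L" and t_L: "t \<in> L"
  by (simp_all add: L_eq)

lemma a_carrier [simp]: "a \<in> carrier G" and t_carrier [simp]: "t \<in> carrier G"
  using a_L t_L L_carrier by blast+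

text \<open>The arcs are the images under \<open>G\<close> of the single pair
  \<open>(v \<one>, v \<tau>)\<close>, so arc-transitivity is built in.\<close>

definition graph where
  "graph = \<lparr>pverts = V, parcs = (\<lambda>g. (v g, v (g \<otimes> \<tau>))) ` carrier G\<rparr>"

lemma pverts_graph [simp]: "pverts graph = V"
  by (simp add: graph_def)

lemma parcs_graph: "parcs graph = (\<lambda>g. (v g, v (g \<otimes> \<tau>))) ` carrier G"
  by (simp add: graph_def)

lemma arcI: "g \<in> carrier G \<Longrightarrow> (v g, v (g \<otimes> \<tau>)) \<in> parcs graph"
  by (auto simp: graph_def)

lemma v_mult_right:
  assumes "g \<in> carrier G" "h \<in> carrier G" "l \<in> L"
  shows "v (g \<otimes> (h \<otimes> l)) = v (g \<otimes> h)"
  using assms by (simp add: m_assoc[symmetric] L_carrier)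

lemma v_t_tau:
  assumes "g \<in> carrier G"
  shows "v (g \<otimes> t \<otimes> \<tau>) = v (g \<otimes> \<tau>)"
proof -
  have "t \<otimes> \<tau> = \<tau> \<otimes> (inv \<tau> \<otimes> t \<otimes> \<tau>)"
    by (simp add: m_assoc[symmetric])
  then have "g \<otimes> t \<otimes> \<tau> = g \<otimes> (\<tau> \<otimes> (inv \<tau> \<otimes> t \<otimes> \<tau>))"
    using assms by (simp add: m_assoc)
  then show ?thesis
    using assms v_mult_right[OF _ _ t_tau] by simp
qed

lemma v_a_tau:
  assumes "g \<in> carrier G"
  shows "v (g \<otimes> \<tau>) \<noteq> v (g \<otimes> a \<otimes> \<tau>)"
  using a_tau v_mult_left[of g \<tau> "a \<otimes> \<tau>"] v_eq_iff[of \<tau> "a \<otimes> \<tau>"] assms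
  by (simp add: m_assoc)

text \<open>Both follow from \<open>v_a_tau\<close>, at \<open>g \<otimes> a\<close> and at
  \<open>g \<otimes> a \<otimes> a\<close>; the latter wraps around by
  \<open>a_cube\<close>.\<close>

lemma v_aa_tau:
  assumes "g \<in> carrier G"
  shows "v (g \<otimes> a \<otimes> \<tau>) \<noteq> v (g \<otimes> a \<otimes> a \<otimes> \<tau>)" "v (g \<otimes> \<tau>) \<noteq> v (g \<otimes> a \<otimes> a \<otimes> \<tau>)"
proof -
  show "v (g \<otimes> a \<otimes> \<tau>) \<noteq> v (g \<otimes> a \<otimes> a \<otimes> \<tau>)"
    using v_a_tau[of "g \<otimes> a"] assms by simp
  have "g \<otimes> a \<otimes> a \<otimes> a = g"
    using assms a_cube by (simp add: m_assoc)
  then show "v (g \<otimes> \<tau>) \<noteq> v (g \<otimes> a \<otimes> a \<otimes> \<tau>)"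
    using v_a_tau[of "g \<otimes> a \<otimes> a"] assms by simp
qed

definition nbrs where "nbrs g = {v (g \<otimes> \<tau>), v (g \<otimes> a \<otimes> \<tau>), v (g \<otimes> a \<otimes> a \<otimes> \<tau>)}"

lemma card_nbrs: "g \<in> carrier G \<Longrightarrow> card (nbrs g) = 3"
  using v_a_tau v_aa_tau by (simp add: nbrs_def)

text \<open>The representatives of \<open>v g\<close> are \<open>g \<otimes> l\<close> with
  \<open>l\<close> among six elements; a trailing \<open>t\<close> is absorbed by
  \<open>v_t_tau\<close>, which leaves the three powers of \<open>a\<close>.\<close>

lemma arc_iff_nbrs:
  assumes g: "g \<in> carrier G"
  shows "(v g, y) \<in> parcs graph \<longleftrightarrow> y \<in> nbrs g"
proof
  assume "(v g, y) \<in> parcs graph"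
  then obtain h where h: "h \<in> carrier G" "v g = v h" "y = v (h \<otimes> \<tau>)"
    by (auto simp: graph_def)
  then obtain l where l: "l \<in> L" "h = g \<otimes> l"
    using g v_eq_obtain by blast
  have "v (g \<otimes> (x \<otimes> t) \<otimes> \<tau>) = v (g \<otimes> x \<otimes> \<tau>)" if "x \<in> carrier G" for x
    using v_t_tau[of "g \<otimes> x"] g that by (simp add: m_assoc)
  from this[of a] this[of "a \<otimes> a"] show "y \<in> nbrs g"
    using l h(3) g v_t_tau[OF g] by (auto simp: L_eq nbrs_def m_assoc)
next
  assume "y \<in> nbrs g"
  then obtain l where "l \<in> L" "y = v (g \<otimes> l \<otimes> \<tau>)"
    using g a_L aa_L subgroup.one_closed[OF L] unfolding nbrs_def
    by (auto simp: m_assoc[of g a a])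
  then show "(v g, y) \<in> parcs graph"
    using arcI[of "g \<otimes> l"] g by (simp add: L_carrier)
qed

text \<open>The arc issued from \<open>g \<otimes> \<tau>\<close> ends at
  \<open>g \<otimes> \<tau> \<otimes> \<tau>\<close>, which names the same vertex as
  \<open>g\<close> by \<open>tau_sq\<close>.\<close>

lemma arc_sym: "(x, y) \<in> parcs graph \<Longrightarrow> (y, x) \<in> parcs graph"
proof -
  assume "(x, y) \<in> parcs graph"
  then obtain g where g: "g \<in> carrier G" "x = v g" "y = v (g \<otimes> \<tau>)"
    by (auto simp: graph_def)
  then show ?thesis
    using arcI[of "g \<otimes> \<tau>"] tau_sq by (simp add: m_assoc)
qed

lemma arcs_subset: "parcs graph \<subseteq> V \<times> V"
  by (auto simp: graph_def)

lemma v_in_half: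
  assumes "g \<in> carrier G"
  shows "v g \<in> half \<one> \<longleftrightarrow> g \<in> H" "v g \<in> half \<tau> \<longleftrightarrow> g \<notin> H"
proof -
  have "(v g \<in> half \<one> \<longleftrightarrow> g \<in> H) \<and> (v g \<in> half \<tau> \<longleftrightarrow> g \<notin> H)"
  proof (cases rule: carrier_cases[OF assms])
    case 1
    then show ?thesis using v_tau_notin by (force simp: half_def)
  next
    case (2 h)
    then show ?thesis using v_tau_notin[of _ h] mult_tau_notin_H by (force simp: half_def)
  qed
  then show "v g \<in> half \<one> \<longleftrightarrow> g \<in> H" "v g \<in> half \<tau> \<longleftrightarrow> g \<notin> H" by blast+
qed

lemma mult_tau_in_H_iff:
  assumes "g \<in> carrier G" shows "g \<otimes> \<tau> \<in> H \<longleftrightarrow> g \<notin> H"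
proof (cases rule: carrier_cases[OF assms])
  case 1
  then show ?thesis using mult_tau_notin_H by blast
next
  case (2 h)
  then have "g \<otimes> \<tau> \<in> H"
    using tau_sq L_H subgroup.m_closed[OF subgroup_H] by (auto simp: m_assoc)
  then show ?thesis using 2 mult_tau_notin_H by blast
qed

lemma bipartition_graph: "bipartition graph (half \<one>) (half \<tau>)"
  unfolding bipartition_def
proof (intro conjI)
  have half_V: "half \<one> \<subseteq> V" "half \<tau> \<subseteq> V"
    by (auto simp: half_def)
  then show "half \<one> \<union> half \<tau> = pverts graph"
    using v_in_half by (auto elim!: V_cases)
  show "half \<one> \<inter> half \<tau> = {}"
    using half_V v_in_half by (auto elim!: V_cases)
  show "\<forall>(x, y)\<in>parcs graph. x \<in> half \<one> \<and> y \<in> half \<tau> \<or> x \<in> half \<tau> \<and> y \<in> half \<one>"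
    by (auto simp: graph_def v_in_half mult_tau_in_H_iff)
qed

lemma finite_V: "finite V"
  using finite_carrier by (simp add: V_def)

lemma pair_graph_graph: "pair_graph graph"
proof
  show "finite (pverts graph)" "finite (parcs graph)"
    using finite_V finite_carrier by (auto simp: graph_def)
  show "symmetric (with_proj graph)"
    using arc_sym by (auto simp: symmetric_def sym_def)
next
  fix e assume e: "e \<in> parcs graph"
  then show "fst e \<in> pverts graph" "snd e \<in> pverts graph"
    using arcs_subset by auto
  show "fst e \<noteq> snd e"
    using e bipartition_graph by (cases e) (force simp: bipartition_def)
qed

lemma regular_graph: "regular_of_valency graph 3"
  unfolding regular_of_valency_def
proof
  fix x assume "x \<in> pverts graph"
  then obtain g where g: "g \<in> carrier G" "x = v g"
    by (auto elim: V_cases)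
  have "out_arcs (with_proj graph) x = Pair x ` nbrs g"
    using arc_iff_nbrs[OF g(1)] g(2) by (auto simp: out_arcs_def)
  then show "out_degree (with_proj graph) x = 3"
    using card_nbrs[OF g(1)] by (simp add: out_degree_def card_image inj_on_def)
qed

text \<open>Right multiplication by an element of \<open>L\<close> keeps the vertex and by
  \<open>\<tau>\<close> follows an arc, so a word in the generators traces a walk.\<close>

lemma connected_graph: "connected (with_proj graph)"
proof -
  interpret pair_graph graph by (rule pair_graph_graph)
  have reach: "\<forall>h\<in>carrier G. v h \<rightarrow>\<^sup>*\<^bsub>with_proj graph\<^esub> v (h \<otimes> g)"
    if "g \<in> generate G (insert \<tau> L)" for g
    using that
  proof induction
    case one
    then show ?case by simp
  next
    case (incl g)
    then show ?case
      using arcI by auto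
  next
    case (inv g)
    have "v (h \<otimes> inv \<tau>) \<rightarrow>\<^bsub>with_proj graph\<^esub> v h" if "h \<in> carrier G" for h
      using arcI[of "h \<otimes> inv \<tau>"] that by (simp add: m_assoc)
    then have "v h \<rightarrow>\<^bsub>with_proj graph\<^esub> v (h \<otimes> inv \<tau>)" if "h \<in> carrier G" for h
      using arc_sym that by simp
    then show ?case
      using inv subgroup.m_inv_closed[OF L] by auto
  next
    case (eng g h)
    then have gh: "g \<in> carrier G" "h \<in> carrier G"
      using generated by auto
    show ?case
    proof
      fix k assume k: "k \<in> carrier G"
      have "v k \<rightarrow>\<^sup>*\<^bsub>with_proj graph\<^esub> v (k \<otimes> g)"
        using eng k by blast
      also have "v (k \<otimes> g) \<rightarrow>\<^sup>*\<^bsub>with_proj graph\<^esub> v (k \<otimes> g \<otimes> h)"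
        using eng k gh by blast
      finally show "v k \<rightarrow>\<^sup>*\<^bsub>with_proj graph\<^esub> v (k \<otimes> (g \<otimes> h))"
        using gh k by (simp add: m_assoc)
    qed
  qed
  have "strongly_connected (with_proj graph)"
  proof (rule strongly_connectedI)
    show "verts (with_proj graph) \<noteq> {}"
      using one_closed by (auto simp: V_def)
  next
    fix x y assume "x \<in> verts (with_proj graph)" "y \<in> verts (with_proj graph)"
    then obtain g h where gh: "g \<in> carrier G" "h \<in> carrier G" "x = v g" "y = v h"
      by (auto elim!: V_cases)
    have "v g \<rightarrow>\<^sup>*\<^bsub>with_proj graph\<^esub> v (g \<otimes> (inv g \<otimes> h))"
      by (rule reach[rule_format]) (use gh generated in auto)
    then show "x \<rightarrow>\<^sup>*\<^bsub>with_proj graph\<^esub> y"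
      using gh by (simp add: m_assoc[symmetric])
  qed
  then show ?thesis
    unfolding connected_def strongly_connected_def
    using reachable_mk_symmetricI by (simp add: pverts_mk_symmetric)
qed

section \<open>Symmetry of the graph and its even subgroup\<close>

lemma subgroup_P_auto: "subgroup P (GraphAutoGroup graph)"
proof -
  have "act g \<in> graph_auto graph" if g: "g \<in> carrier G" for g
  proof -
    \<comment> \<open>Left multiplication commutes with the right multiplication by
      \<open>\<tau>\<close> that defines arcs; applied to \<open>inv g\<close> it also gives the
      converse.\<close>
    have pres: "(act k x, act k y) \<in> parcs graph" if "k \<in> carrier G" "(x, y) \<in> parcs graph" for k x y
    proof -
      from that obtain h where h: "h \<in> carrier G" "x = v h" "y = v (h \<otimes> \<tau>)"
        by (auto simp: graph_def)
      then show ?thesis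
        using arcI[of "k \<otimes> h"] that by (simp add: m_assoc)
    qed
    have "act (inv g) (act g x) = x" if "x \<in> V" for x
      using that g by (auto elim!: V_cases simp: m_assoc[symmetric])
    then show ?thesis
      using pres[of g] pres[of "inv g" "act g _" "act g _"] g act_Bij by (simp add: graph_auto_def) metis
  qed
  then show ?thesis
    using subgroup_P by (auto simp: subgroup_GraphAutoGroup_iff P_def)
qed

lemma s_arcs_1_iff: "xs \<in> s_arcs graph 1 \<longleftrightarrow> (\<exists>x y. xs = [x, y] \<and> (x, y) \<in> parcs graph)"
proof -
  have *: "i = Suc 0" if "Suc 0 \<le> i" "i \<le> Suc 0" for i using that by simp
  show ?thesis
    using arcs_subset by (auto simp: s_arcs_def length_Suc_conv dest!: *)
qed

lemma s_arcs_2_iff: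
  "xs \<in> s_arcs graph 2 \<longleftrightarrow>
    (\<exists>x y z. xs = [x, y, z] \<and> (x, y) \<in> parcs graph \<and> (y, z) \<in> parcs graph \<and> x \<noteq> z)"
proof -
  have "(\<forall>i. 1 \<le> i \<and> i \<le> 2 \<longrightarrow> Q i) \<longleftrightarrow> Q 1 \<and> Q 2" for Q :: "nat \<Rightarrow> bool"
    by (metis le_antisym le_refl not_less_eq_eq numeral_2_eq_2 One_nat_def one_le_numeral)
  moreover have "(\<forall>j. 1 \<le> j \<and> j + 1 \<le> 2 \<longrightarrow> Q j) \<longleftrightarrow> Q 1" for Q :: "nat \<Rightarrow> bool"
    by (auto simp: le_Suc_eq numeral_2_eq_2)
  moreover have "length xs = 2 + 1 \<longleftrightarrow> (\<exists>x y z. xs = [x, y, z])"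
    by (simp add: length_Suc_conv numeral_2_eq_2) blast
  ultimately have "xs \<in> s_arcs graph 2 \<longleftrightarrow> (\<exists>x y z. xs = [x, y, z]) \<and> set xs \<subseteq> V \<and>
      ((xs ! (1 - 1), xs ! 1) \<in> parcs graph \<and> (xs ! (2 - 1), xs ! 2) \<in> parcs graph) \<and>
      xs ! (1 - 1) \<noteq> xs ! (1 + 1)"
    by (simp only: s_arcs_def mem_Collect_eq pverts_graph)
  then show ?thesis
    using arcs_subset by auto
qed

text \<open>The stabiliser \<open>L\<close> of \<open>v \<one>\<close> induces the symmetric group on its three neighbours.\<close>

lemma two_arc_standard:
  assumes "xs \<in> s_arcs graph 2"
  obtains k where "k \<in> carrier G" "xs = [v (k \<otimes> \<tau>), v k, v (k \<otimes> a \<otimes> \<tau>)]"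
proof -
  obtain x y z where xs: "xs = [x, y, z]" and arcs: "(x, y) \<in> parcs graph" "(y, z) \<in> parcs graph" "x \<noteq> z"
    using assms by (auto simp: s_arcs_2_iff)
  obtain g where g: "g \<in> carrier G" "y = v g"
    using arcs(1) arcs_subset by (auto elim: V_cases)
  have nb: "x \<in> nbrs g" "z \<in> nbrs g"
    using arcs arc_sym g arc_iff_nbrs by blast+
  have yl: "v (g \<otimes> l) = y" if "l \<in> L" for l
    using that g by simp
  have aaa: "g \<otimes> a \<otimes> a \<otimes> a = g"
    using g a_cube by (simp add: m_assoc)
  have ta: "h \<otimes> t \<otimes> a \<otimes> \<tau> = h \<otimes> a \<otimes> a \<otimes> t \<otimes> \<tau>" if "h \<in> carrier G" for h
  proof -
    have "h \<otimes> t \<otimes> a \<otimes> \<tau> = h \<otimes> (t \<otimes> a) \<otimes> \<tau>"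
      using that by (simp add: m_assoc)
    then show ?thesis
      using that by (simp add: t_a m_assoc)
  qed
  \<comment> \<open>The six ordered pairs of distinct neighbours correspond to the six elements
    \<open>l\<close> of \<open>L\<close>: the witness \<open>g \<otimes> l\<close> carries the pair
    \<open>v \<tau>\<close>, \<open>v (a \<otimes> \<tau>)\<close> to \<open>x\<close>,
    \<open>z\<close>.\<close>
  consider "x = v (g \<otimes> \<tau>)" "z = v (g \<otimes> a \<otimes> \<tau>)"
    | "x = v (g \<otimes> \<tau>)" "z = v (g \<otimes> a \<otimes> a \<otimes> \<tau>)"
    | "x = v (g \<otimes> a \<otimes> \<tau>)" "z = v (g \<otimes> a \<otimes> a \<otimes> \<tau>)"
    | "x = v (g \<otimes> a \<otimes> \<tau>)" "z = v (g \<otimes> \<tau>)"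
    | "x = v (g \<otimes> a \<otimes> a \<otimes> \<tau>)" "z = v (g \<otimes> \<tau>)"
    | "x = v (g \<otimes> a \<otimes> a \<otimes> \<tau>)" "z = v (g \<otimes> a \<otimes> \<tau>)"
    using nb arcs(3) by (auto simp: nbrs_def)
  then have "\<exists>k\<in>carrier G. v k = y \<and> v (k \<otimes> \<tau>) = x \<and> v (k \<otimes> a \<otimes> \<tau>) = z"
  proof cases
    case 1
    then show ?thesis using g by (intro bexI[of _ g]) auto
  next
    case 2
    then show ?thesis
      using g yl[OF t_L] by (intro bexI[of _ "g \<otimes> t"]) (auto simp: ta v_t_tau)
  next
    case 3
    then show ?thesis
      using g yl[OF a_L] by (intro bexI[of _ "g \<otimes> a"]) auto
  next
    case 4
    then show ?thesis
      using g a_L t_L by (intro bexI[of _ "g \<otimes> a \<otimes> t"]) (auto simp: ta v_t_tau aaa)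
  next
    case 5
    then show ?thesis
      using g a_L by (intro bexI[of _ "g \<otimes> a \<otimes> a"]) (auto simp: aaa)
  next
    case 6
    then show ?thesis
      using g a_L t_L by (intro bexI[of _ "g \<otimes> a \<otimes> a \<otimes> t"]) (auto simp: ta v_t_tau aaa)
  qed
  then show ?thesis
    using that xs by blast
qed

text \<open>Every 1-arc and every 2-arc is a translate of a standard one, so
  \<open>h \<otimes> inv g\<close> carries the translate by \<open>g\<close> to the translate by
  \<open>h\<close>.\<close>

lemma two_arc_transitive: "s_arc_transitive graph P 2"
proof -
  have "[v \<tau>, v \<one>, v (a \<otimes> \<tau>)] \<in> s_arcs graph 2"
    using arcI[of \<one>] arcI[of a] arc_sym v_a_tau[of \<one>] arc_iff_nbrs[of \<one>]
    by (auto simp: s_arcs_2_iff nbrs_def)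
  then have "s_arcs graph 2 \<noteq> {}" by blast
  moreover have "transitive_action (perm_group (pverts graph) P) (s_arcs graph i)
      (\<lambda>g. \<lambda>vs \<in> s_arcs graph i. map g vs)" if i: "1 \<le> i \<and> i \<le> 2" for i
  proof (rule transitive_action_s_arcs[OF subgroup_P_auto])
    fix xs ys assume xy: "xs \<in> s_arcs graph i" "ys \<in> s_arcs graph i"
    consider "i = 1" | "i = 2" using i by linarith
    then show "\<exists>g\<in>P. map g xs = ys"
    proof cases
      case 1
      with xy obtain g h where gh: "g \<in> carrier G" "h \<in> carrier G"
        "xs = [v g, v (g \<otimes> \<tau>)]" "ys = [v h, v (h \<otimes> \<tau>)]"
        unfolding 1 s_arcs_1_iff by (auto simp: parcs_graph)
      have "map (act (h \<otimes> inv g)) xs = ys"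
        using gh by (simp add: m_assoc[of h]) (simp add: m_assoc[symmetric])
      then show ?thesis using gh by (auto simp: P_def)
    next
      case 2
      with xy obtain g h where gh: "g \<in> carrier G" "h \<in> carrier G"
        "xs = [v (g \<otimes> \<tau>), v g, v (g \<otimes> a \<otimes> \<tau>)]" "ys = [v (h \<otimes> \<tau>), v h, v (h \<otimes> a \<otimes> \<tau>)]"
        by (metis two_arc_standard)
      have "h \<otimes> inv g \<otimes> (g \<otimes> x) = h \<otimes> x" if "x \<in> carrier G" for x
        using gh that by (simp add: m_assoc[of h]) (simp add: m_assoc[symmetric])
      then have "map (act (h \<otimes> inv g)) xs = ys"
        using gh by (simp add: m_assoc)
      then show ?thesis using gh by (auto simp: P_def)
    qed
  qed
  ultimately show ?thesis
    by (simp add: s_arc_transitive_def)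
qed

text \<open>Elements fixing a vertex come from conjugates of \<open>L\<close>, which lie in the
  normal subgroup \<open>H\<close>. Conversely, the stabilisers together are closed under
  conjugation, so they generate a normal subgroup; it contains the nontrivial \<open>act a\<close>
  and hence the image of \<open>H\<close>.\<close>

lemma even_subgroup_eq: "even_subgroup graph P = act ` H"
proof -
  let ?S = "\<Union>x \<in> V. stabilizer (perm_group V P) (\<lambda>g. g) x"
  let ?E = "generate (perm_group V P) ?S"
  have stab: "f \<in> ?S \<longleftrightarrow> (\<exists>g\<in>carrier G. \<exists>h\<in>carrier G. f = act g \<and> v (g \<otimes> h) = v h)" for f
    by (fastforce simp: stabilizer_def P_def V_def)
  have "?S \<subseteq> act ` H"
  proof
    fix f assume "f \<in> ?S"
    then obtain g h where gh: "g \<in> carrier G" "h \<in> carrier G" "f = act g" "v (g \<otimes> h) = v h"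
      using stab by blast
    then have "inv h \<otimes> (g \<otimes> h) \<in> L"
      using v_eq_iff[of h "g \<otimes> h"] by simp
    then have "inv h \<otimes> (g \<otimes> h) \<in> H"
      using L_H by blast
    then have "h \<otimes> (inv h \<otimes> (g \<otimes> h)) \<otimes> inv h \<in> H"
      using normal.inv_op_closed2[OF H] gh by blast
    also have "h \<otimes> (inv h \<otimes> (g \<otimes> h)) \<otimes> inv h = g"
      using gh by (simp add: m_assoc[symmetric]) (simp add: m_assoc)
    finally show "f \<in> act ` H"
      using gh by blast
  qed
  then have "?E \<subseteq> act ` H"
    by (rule act.H.generate_subgroup_incl)
      (use nontrivial_normal_act_H in \<open>simp add: nontrivial_normal_def normal_imp_subgroup\<close>)
  moreover have "?E \<lhd> perm_group V P"
  proof (rule act.H.normal_generateI)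
    show "?S \<subseteq> carrier (perm_group V P)"
      using stab by (auto simp: P_def)
    fix f k assume "f \<in> ?S" "k \<in> carrier (perm_group V P)"
    then obtain g h k' where gh: "g \<in> carrier G" "h \<in> carrier G" "f = act g" "v (g \<otimes> h) = v h"
      "k' \<in> carrier G" "k = act k'"
      using stab by (auto simp: P_def)
    have "k \<otimes>\<^bsub>perm_group V P\<^esub> f \<otimes>\<^bsub>perm_group V P\<^esub> inv\<^bsub>perm_group V P\<^esub> k = act (k' \<otimes> g \<otimes> inv k')"
      using gh by (simp add: act.hom_mult act.hom_inv)
    moreover have "v (k' \<otimes> g \<otimes> inv k' \<otimes> (k' \<otimes> h)) = v (k' \<otimes> h)"
    proof -
      have "inv k' \<otimes> (k' \<otimes> h) = h"
        using gh by (simp add: m_assoc[symmetric])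
      then have "k' \<otimes> g \<otimes> inv k' \<otimes> (k' \<otimes> h) = k' \<otimes> (g \<otimes> h)"
        using gh by (simp add: m_assoc)
      then show ?thesis
        using gh by (simp add: v_mult_left)
    qed
    ultimately show "k \<otimes>\<^bsub>perm_group V P\<^esub> f \<otimes>\<^bsub>perm_group V P\<^esub> inv\<^bsub>perm_group V P\<^esub> k \<in> ?S"
      using stab gh by (meson inv_closed m_closed)
  qed
  moreover have "act a \<in> ?E"
    using stab a_L by (intro generate.incl) (force intro: bexI[of _ a] bexI[of _ \<one>])
  moreover have "act a \<noteq> \<one>\<^bsub>perm_group V P\<^esub>"
    using v_a_tau[of \<one>] act_eq_one_imp[of a \<tau>] by auto
  ultimately show ?thesis
    using normal_contains_act_H[of ?E] unfolding even_subgroup_def nontrivial_normal_def by auto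
qed

text \<open>Through \<open>v_eq_iff\<close>, \<open>inv k \<otimes> h \<notin> L\<close> says that
  \<open>k\<close> and \<open>h\<close> send \<open>v \<one>\<close> to different vertices;
  conjugation by \<open>\<tau>\<close> gives the analogue for \<open>v \<tau>\<close>. One normal
  subgroup \<open>K\<close> of \<open>H\<close> thus settles both halves.\<close>

lemma graph_properties:
  assumes K: "K \<lhd> G\<lparr>carrier := H\<rparr>"
    and moved: "\<exists>k\<in>K. k \<notin> L" "\<exists>k\<in>K. inv \<tau> \<otimes> k \<otimes> \<tau> \<notin> L"
    and intransitive: "h \<in> H" "\<And>k. k \<in> K \<Longrightarrow> inv k \<otimes> h \<notin> L"
      "h' \<in> H" "\<And>k. k \<in> K \<Longrightarrow> inv \<tau> \<otimes> (inv k \<otimes> h') \<otimes> \<tau> \<notin> L"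
  shows "pair_graph graph \<and> connected (with_proj graph) \<and> regular_of_valency graph 3 \<and>
    (\<exists>A B. bipartition graph A B \<and>
      (\<exists>G. subgroup G (GraphAutoGroup graph) \<and>
        s_arc_transitive graph G 2 \<and>
        biquasiprimitive (pverts graph) G \<and>
        \<not> quasiprimitive_on (even_subgroup graph G) A \<and>
        \<not> quasiprimitive_on (even_subgroup graph G) B))"
proof -
  have KH: "k \<in> H" if "k \<in> K" for k
    using subgroup.mem_carrier[OF normal_imp_subgroup[OF K] that] by simp
  have "\<exists>k\<in>K. v (k \<otimes> \<one>) \<noteq> v \<one>"
    using moved(1) KH v_eq_iff[OF one_closed] by (metis H_carrier inv_one l_one r_one)
  moreover have "v (k \<otimes> \<one>) \<noteq> v (h \<otimes> \<one>)" if "k \<in> K" for k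
    using intransitive(1,2) KH that by (simp add: v_eq_iff)
  ultimately have A: "\<not> quasiprimitive_on (act ` H) (half \<one>)"
    using half_not_quasiprimitive[OF one_closed K] intransitive(1) by metis
  have "\<exists>k\<in>K. v (k \<otimes> \<tau>) \<noteq> v \<tau>"
    using moved(2) KH v_eq_iff[of \<tau> "_ \<otimes> \<tau>"] by (metis H_carrier inv_closed m_assoc m_closed tau)
  moreover have "v (k \<otimes> \<tau>) \<noteq> v (h' \<otimes> \<tau>)" if "k \<in> K" for k
    using intransitive(3) intransitive(4)[OF that] KH[OF that] by (simp add: v_eq_iff inv_mult_group m_assoc)
  ultimately have B: "\<not> quasiprimitive_on (act ` H) (half \<tau>)"
    using half_not_quasiprimitive[OF tau K] intransitive(3) by metis
  show ?thesis
    using pair_graph_graph connected_graph regular_graph bipartition_graph subgroup_P_auto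
      two_arc_transitive biquasiprimitive_P even_subgroup_eq A B by (metis pverts_graph)
qed

end

section \<open>The wreath product of a simple group\<close>

text \<open>The relations move every \<open>t\<close> to the right and shorten powers of
  \<open>a\<close>, so products of the six words stay among them; each inverse is found in the
  list.\<close>

lemma (in group) dihedral_six_subgroup:
  assumes [simp]: "a \<in> carrier G" "t \<in> carrier G"
    and aaa: "a \<otimes> a \<otimes> a = \<one>" and tt: "t \<otimes> t = \<one>" and ta: "t \<otimes> a = a \<otimes> a \<otimes> t"
  shows "subgroup {\<one>, a, a \<otimes> a, t, a \<otimes> t, a \<otimes> a \<otimes> t} G"
proof -
  have aaa': "a \<otimes> (a \<otimes> a) = \<one>" and ta': "t \<otimes> a = a \<otimes> (a \<otimes> t)"
    using aaa ta by (simp_all add: m_assoc)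
  have ext: "a \<otimes> (a \<otimes> (a \<otimes> x)) = x" "t \<otimes> (t \<otimes> x) = x" "t \<otimes> (a \<otimes> x) = a \<otimes> (a \<otimes> (t \<otimes> x))"
    if "x \<in> carrier G" for x
    using that aaa' tt ta' by (simp_all add: m_assoc[symmetric])
  note rules = aaa' ta' ext tt m_assoc
  let ?S = "{\<one>, a, a \<otimes> a, t, a \<otimes> t, a \<otimes> a \<otimes> t}"
  have closed: "x \<otimes> y \<in> ?S" if "x \<in> ?S" "y \<in> ?S" for x y
    using that by (elim insertE emptyE) (simp_all add: rules)
  have inverse: "inv x \<in> ?S" if "x \<in> ?S" for x
  proof -
    have "\<exists>y\<in>?S. y \<otimes> x = \<one>"
      using that by (elim insertE emptyE) (simp_all add: rules)
    then obtain y where y: "y \<in> ?S" "y \<otimes> x = \<one>" by blast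
    moreover have "x \<in> carrier G" "y \<in> carrier G"
      using that y by auto
    ultimately show ?thesis
      using inv_equality by blast
  qed
  show ?thesis
    by (rule subgroupI) (use closed inverse in \<open>simp_all, blast?\<close>)
qed

text \<open>The finitely many left cosets \<open>?C g\<close> inject into the natural
  numbers.\<close>

lemma (in group) ex_coset_labelling:
  assumes fin: "finite (carrier G)" and L: "subgroup L G"
  shows "\<exists>v :: 'a \<Rightarrow> nat. \<forall>g\<in>carrier G. \<forall>h\<in>carrier G. v g = v h \<longleftrightarrow> inv g \<otimes> h \<in> L"
proof -
  let ?C = "\<lambda>g. {k \<in> carrier G. inv g \<otimes> k \<in> L}"
  have "finite (?C ` carrier G)"
    using fin by simp
  then obtain e :: "'a set \<Rightarrow> nat" where e: "inj_on e (?C ` carrier G)"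
    using finite_imp_inj_to_nat_seg[of "?C ` carrier G"] by blast
  have "?C g = ?C h \<longleftrightarrow> inv g \<otimes> h \<in> L" if gh: "g \<in> carrier G" "h \<in> carrier G" for g h
  proof
    assume "?C g = ?C h"
    moreover have "h \<in> ?C h"
      using gh subgroup.one_closed[OF L] by simp
    ultimately show "inv g \<otimes> h \<in> L" by blast
  next
    assume gL: "inv g \<otimes> h \<in> L"
    have g_k: "inv g \<otimes> h \<otimes> (inv h \<otimes> k) = inv g \<otimes> k" if "k \<in> carrier G" for k
    proof -
      have "h \<otimes> (inv h \<otimes> k) = k" using gh that by (simp add: m_assoc[symmetric])
      then show ?thesis using gh that by (simp add: m_assoc)
    qed
    have h_k: "inv (inv g \<otimes> h) \<otimes> (inv g \<otimes> k) = inv h \<otimes> k" if "k \<in> carrier G" for k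
    proof -
      have "g \<otimes> (inv g \<otimes> k) = k" using gh that by (simp add: m_assoc[symmetric])
      then show ?thesis using gh that by (simp add: m_assoc inv_mult_group)
    qed
    show "?C g = ?C h"
      using g_k h_k subgroup.m_closed[OF L gL] subgroup.m_closed[OF L subgroup.m_inv_closed[OF L gL]]
      by force
  qed
  then have "\<forall>g\<in>carrier G. \<forall>h\<in>carrier G. e (?C g) = e (?C h) \<longleftrightarrow> inv g \<otimes> h \<in> L"
    using inj_on_eq_iff[OF e] by auto
  then show ?thesis
    by (rule exI[of _ "\<lambda>g. e (?C g)"])
qed

text \<open>The flag of the left factor swaps the coordinates of the right one, so a triple with
  flag \<open>True\<close> is a base element times the swap on its right.\<close>

definition wreath2 :: "('a, 'b) monoid_scheme \<Rightarrow> ('a \<times> 'a \<times> bool) monoid" where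
  "wreath2 T = \<lparr>carrier = carrier T \<times> carrier T \<times> UNIV,
    monoid.mult = (\<lambda>(x, y, e) (x', y', e').
      if e then (x \<otimes>\<^bsub>T\<^esub> y', y \<otimes>\<^bsub>T\<^esub> x', \<not> e') else (x \<otimes>\<^bsub>T\<^esub> x', y \<otimes>\<^bsub>T\<^esub> y', e')),
    one = (\<one>\<^bsub>T\<^esub>, \<one>\<^bsub>T\<^esub>, False)\<rparr>"

lemma wreath2_simps [simp]:
  "(x, y, e) \<in> carrier (wreath2 T) \<longleftrightarrow> x \<in> carrier T \<and> y \<in> carrier T"
  "(x, y, False) \<otimes>\<^bsub>wreath2 T\<^esub> (x', y', e') = (x \<otimes>\<^bsub>T\<^esub> x', y \<otimes>\<^bsub>T\<^esub> y', e')"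
  "(x, y, True) \<otimes>\<^bsub>wreath2 T\<^esub> (x', y', e') = (x \<otimes>\<^bsub>T\<^esub> y', y \<otimes>\<^bsub>T\<^esub> x', \<not> e')"
  "\<one>\<^bsub>wreath2 T\<^esub> = (\<one>\<^bsub>T\<^esub>, \<one>\<^bsub>T\<^esub>, False)"
  by (simp_all add: wreath2_def)

lemma (in group) group_wreath2: "group (wreath2 G)"
proof (rule groupI)
  fix g assume "g \<in> carrier (wreath2 G)"
  then obtain x y e where g: "g = (x, y, e)" "x \<in> carrier G" "y \<in> carrier G"
    by (cases g) auto
  show "\<exists>h\<in>carrier (wreath2 G). h \<otimes>\<^bsub>wreath2 G\<^esub> g = \<one>\<^bsub>wreath2 G\<^esub>"
    using g by (intro bexI[of _ "if e then (inv y, inv x, True) else (inv x, inv y, False)"])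
      (cases e; simp)+
next
  fix g h k assume "g \<in> carrier (wreath2 G)" "h \<in> carrier (wreath2 G)" "k \<in> carrier (wreath2 G)"
  then show "g \<otimes>\<^bsub>wreath2 G\<^esub> h \<otimes>\<^bsub>wreath2 G\<^esub> k = g \<otimes>\<^bsub>wreath2 G\<^esub> (h \<otimes>\<^bsub>wreath2 G\<^esub> k)"
    by (auto simp: wreath2_def m_assoc)
qed (auto simp: wreath2_def)

text \<open>\<open>b \<otimes> (a \<otimes> a)\<close> is \<open>b\<close> times the inverse of
  \<open>a\<close>, the image of \<open>a \<otimes> b\<close> under an automorphism sending
  \<open>a\<close> to \<open>b\<close> and \<open>b\<close> to the inverse of \<open>a\<close>.
  \<open>d_conj\<close> and \<open>not_conj\<close> exclude such an automorphism.\<close>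

locale generating_triple = group T for T :: "('a, 'm) monoid_scheme" (structure) +
  fixes a b t d :: 'a
  assumes finite_T: "finite (carrier T)"
    and abt [simp]: "a \<in> carrier T" "b \<in> carrier T" "t \<in> carrier T" "d \<in> carrier T"
    and aaa: "a \<otimes> a \<otimes> a = \<one>" and bbb: "b \<otimes> b \<otimes> b = \<one>" and tt: "t \<otimes> t = \<one>"
    and ta: "t \<otimes> a = a \<otimes> a \<otimes> t" and tb: "t \<otimes> b = b \<otimes> b \<otimes> t"
    and a1: "a \<noteq> \<one>" and b1: "b \<noteq> \<one>" and ab: "a \<noteq> b" "a \<noteq> b \<otimes> b"
    and simple: "\<And>N. N \<lhd> T \<Longrightarrow> N \<noteq> {\<one>} \<Longrightarrow> N = carrier T"
    and generated_ab: "\<And>S. subgroup S T \<Longrightarrow> a \<in> S \<Longrightarrow> b \<in> S \<Longrightarrow> S = carrier T"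
    and d_conj: "d \<otimes> (a \<otimes> b) \<otimes> inv d = (a \<otimes> b) [^] (4::nat)"
    and not_conj: "\<And>x. x \<in> carrier T \<Longrightarrow>
      x \<otimes> (b \<otimes> (a \<otimes> a)) \<otimes> inv x \<noteq> (b \<otimes> (a \<otimes> a)) [^] (4::nat)"
begin

abbreviation W where "W \<equiv> wreath2 T"

sublocale W: group W
  by (rule group_wreath2)

lemma inv_W [simp]:
  assumes "x \<in> carrier T" "y \<in> carrier T"
  shows "inv\<^bsub>W\<^esub> (x, y, False) = (inv x, inv y, False)"
    "inv\<^bsub>W\<^esub> (x, y, True) = (inv y, inv x, True)"
  by (rule W.inv_equality; use assms in simp)+

lemma inv_t [simp]: "inv t = t"
  using tt inv_equality by simp

lemma aaa' [simp]: "a \<otimes> (a \<otimes> a) = \<one>" and bbb' [simp]: "b \<otimes> (b \<otimes> b) = \<one>"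
  using aaa bbb by (simp_all add: m_assoc)

lemma ta' : "t \<otimes> a = a \<otimes> (a \<otimes> t)" and tb': "t \<otimes> b = b \<otimes> (b \<otimes> t)"
  using ta tb by (simp_all add: m_assoc)

lemma ext_rules:
  assumes "x \<in> carrier T"
  shows "a \<otimes> (a \<otimes> (a \<otimes> x)) = x" "b \<otimes> (b \<otimes> (b \<otimes> x)) = x" "t \<otimes> (t \<otimes> x) = x"
    "t \<otimes> (a \<otimes> x) = a \<otimes> (a \<otimes> (t \<otimes> x))" "t \<otimes> (b \<otimes> x) = b \<otimes> (b \<otimes> (t \<otimes> x))"
  using assms aaa bbb tt ta tb by (simp_all add: m_assoc[symmetric])

lemmas rules = ext_rules ta' tb' tt m_assoc

lemma aa1: "a \<otimes> a \<noteq> \<one>" and bb1: "b \<otimes> b \<noteq> \<one>"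
  using aaa bbb a1 b1 by auto

lemma reflection_sq:
  "x \<in> {t, a \<otimes> t, a \<otimes> a \<otimes> t, b \<otimes> t, b \<otimes> b \<otimes> t} \<Longrightarrow> x \<otimes> x = \<one>"
  by (auto simp: rules)

text \<open>Reflections square to the identity and \<open>b\<close> does not; the nontrivial powers
  of \<open>a\<close> are excluded by \<open>ab\<close>.\<close>

lemma b_notin: "b \<notin> {\<one>, a, a \<otimes> a, t, a \<otimes> t, a \<otimes> a \<otimes> t}"
proof -
  have "b \<noteq> a \<otimes> a"
  proof
    assume "b = a \<otimes> a"
    then have "b \<otimes> b = a" by (simp add: rules)
    then show False using ab by simp
  qed
  then show ?thesis
    using b1 ab(1) bb1 reflection_sq by blast
qed

lemma a_notin: "a \<notin> {\<one>, b, b \<otimes> b, t, b \<otimes> t, b \<otimes> b \<otimes> t}"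
  using a1 ab aa1 reflection_sq by blast

lemma b_reflection_neq_one: "t \<noteq> \<one>" "b \<otimes> t \<noteq> \<one>" "b \<otimes> b \<otimes> t \<noteq> \<one>"
proof -
  show t: "t \<noteq> \<one>"
  proof
    assume "t = \<one>"
    then have "b = b \<otimes> b" using tb by simp
    then show False using b1 by (simp add: l_cancel_one')
  qed
  have "x \<otimes> t \<noteq> \<one>" if "x \<in> carrier T" "x \<otimes> x \<noteq> \<one>" for x
  proof
    assume "x \<otimes> t = \<one>"
    then have "x = t" using that by (metis abt(3) inv_equality inv_t)
    then show False using that tt by simp
  qed
  from this[of b] this[of "b \<otimes> b"] show "b \<otimes> t \<noteq> \<one>" "b \<otimes> b \<otimes> t \<noteq> \<one>"
    using bb1 b1 by (simp_all add: rules)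
qed

section \<open>The subgroups of the wreath product that define the graph\<close>

definition A where "A = (a, b, False)"
definition S where "S = (t, t, False)"
definition \<tau> where "\<tau> = (\<one>, t, True)"
definition L where "L = {\<one>\<^bsub>W\<^esub>, A, A \<otimes>\<^bsub>W\<^esub> A, S, A \<otimes>\<^bsub>W\<^esub> S, A \<otimes>\<^bsub>W\<^esub> A \<otimes>\<^bsub>W\<^esub> S}"
definition H where "H = carrier T \<times> carrier T \<times> {False}"
text \<open>The first direct factor of the base group, which breaks quasiprimitivity on both
  halves.\<close>

definition K where "K = carrier T \<times> {\<one>} \<times> {False}"

lemma H_iff [simp]: "(x, y, e) \<in> H \<longleftrightarrow> x \<in> carrier T \<and> y \<in> carrier T \<and> \<not> e"
  by (auto simp: H_def)

lemma L_eq: "L = {(\<one>, \<one>, False), (a, b, False), (a \<otimes> a, b \<otimes> b, False), (t, t, False),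
  (a \<otimes> t, b \<otimes> t, False), (a \<otimes> a \<otimes> t, b \<otimes> b \<otimes> t, False)}"
  by (simp add: L_def A_def S_def)

lemma in_L_fst: "(x, y, e) \<in> L \<Longrightarrow> x \<in> {\<one>, a, a \<otimes> a, t, a \<otimes> t, a \<otimes> a \<otimes> t}"
  and in_L_snd: "(x, y, e) \<in> L \<Longrightarrow> y \<in> {\<one>, b, b \<otimes> b, t, b \<otimes> t, b \<otimes> b \<otimes> t}"
  unfolding L_eq by auto

text \<open>No listed second coordinate other than the first is trivial. So \<open>L\<close> meets
  \<open>K\<close> trivially, which shows that \<open>K\<close> acts nontrivially and bounds the
  number of vertices from below.\<close>

lemma in_L_snd_one: "(x, \<one>, e) \<in> L \<Longrightarrow> x = \<one>"
  using b1 bb1 b_reflection_neq_one unfolding L_eq by auto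

lemma subgroup_L: "subgroup L W"
  unfolding L_def
  by (rule W.dihedral_six_subgroup) (simp_all add: A_def S_def aaa bbb tt ta tb)

lemma normal_H: "H \<lhd> W"
  unfolding W.normal_inv_iff
proof (intro conjI ballI)
  show "subgroup H W"
    by (rule W.subgroupI) (auto simp: H_def)
  fix g h assume "g \<in> carrier W" "h \<in> H"
  then show "g \<otimes>\<^bsub>W\<^esub> h \<otimes>\<^bsub>W\<^esub> inv\<^bsub>W\<^esub> g \<in> H"
    by (cases g; cases "snd (snd g)") (auto simp: H_def)
qed

text \<open>The centre is normal, so if nontrivial it would be all of \<open>T\<close>; then
  \<open>t\<close> would commute with \<open>a\<close>, against \<open>ta\<close>.\<close>

lemma center_trivial:
  assumes x: "x \<in> carrier T" and c: "\<And>y. y \<in> carrier T \<Longrightarrow> x \<otimes> y = y \<otimes> x"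
  shows "x = \<one>"
proof (rule ccontr)
  assume "x \<noteq> \<one>"
  let ?Z = "{z \<in> carrier T. \<forall>y\<in>carrier T. z \<otimes> y = y \<otimes> z}"
  have Z: "z \<in> carrier T" "z \<otimes> y = y \<otimes> z" if "z \<in> ?Z" "y \<in> carrier T" for z y
    using that by blast+
  have "subgroup ?Z T"
  proof (rule subgroupI)
    show "?Z \<noteq> {}" using x c by blast
  next
    fix z assume z: "z \<in> ?Z"
    have "inv z \<otimes> y = y \<otimes> inv z" if y: "y \<in> carrier T" for y
    proof -
      have zc: "z \<in> carrier T" using z by blast
      have "inv z \<otimes> y = inv z \<otimes> (y \<otimes> z) \<otimes> inv z"
        using y zc by (simp add: m_assoc)
      also have "y \<otimes> z = z \<otimes> y"
        using Z(2)[OF z y] by (rule sym)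
      also have "inv z \<otimes> (z \<otimes> y) \<otimes> inv z = y \<otimes> inv z"
        using y zc by (simp add: m_assoc[symmetric])
      finally show ?thesis .
    qed
    then show "inv z \<in> ?Z" using z by blast
  next
    fix z w assume z: "z \<in> ?Z" and w: "w \<in> ?Z"
    then have zw: "z \<in> carrier T" "w \<in> carrier T" by blast+
    have "z \<otimes> w \<otimes> y = y \<otimes> (z \<otimes> w)" if y: "y \<in> carrier T" for y
    proof -
      have "z \<otimes> w \<otimes> y = z \<otimes> (y \<otimes> w)"
        using Z(2)[OF w y] y zw by (simp only: m_assoc)
      also have "\<dots> = y \<otimes> z \<otimes> w"
        using Z(2)[OF z y] y zw by (simp only: m_assoc[symmetric])
      also have "\<dots> = y \<otimes> (z \<otimes> w)"
        using y zw by (rule m_assoc)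
      finally show ?thesis .
    qed
    then show "z \<otimes> w \<in> ?Z" using zw by blast
  qed blast
  moreover have "y \<otimes> z \<otimes> inv y \<in> ?Z" if y: "y \<in> carrier T" and z: "z \<in> ?Z" for y z
  proof -
    have "y \<otimes> z \<otimes> inv y = z \<otimes> y \<otimes> inv y"
      using Z(2)[OF z y] by simp
    also have "\<dots> = z"
      using Z(1)[OF z y] y by (simp add: m_assoc)
    finally show ?thesis using z by simp
  qed
  ultimately have "?Z \<lhd> T"
    unfolding normal_inv_iff by blast
  moreover have "?Z \<noteq> {\<one>}"
    using x c \<open>x \<noteq> \<one>\<close> by blast
  ultimately have "?Z = carrier T"
    using simple by blast
  then have "t \<otimes> a = a \<otimes> t"
    using abt by blast
  then have "a \<otimes> (a \<otimes> t) = a \<otimes> t" using ta' by simp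
  then show False using a1 by simp
qed

text \<open>Commutators with elements of \<open>N\<close> stay in \<open>N\<close>. One brings a
  nontrivial element into the base group, another makes its second coordinate trivial; simplicity
  then yields the first factor and the swap yields the second.\<close>

lemma normal_contains_H:
  assumes N: "N \<lhd> W" and N1: "N \<noteq> {\<one>\<^bsub>W\<^esub>}"
  shows "H \<subseteq> N"
proof -
  have sub: "subgroup N W" using N by (rule normal_imp_subgroup)
  have conj: "g \<otimes>\<^bsub>W\<^esub> n \<otimes>\<^bsub>W\<^esub> inv\<^bsub>W\<^esub> g \<in> N" if "g \<in> carrier W" "n \<in> N" for g n
    using normal.inv_op_closed2[OF N that] .
  have N_carrier: "x \<in> carrier T" "y \<in> carrier T" if "(x, y, e) \<in> N" for x y e
    using subgroup.mem_carrier[OF sub that] by simp_all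
  have mult: "m \<otimes>\<^bsub>W\<^esub> n \<in> N" "inv\<^bsub>W\<^esub> n \<in> N" if "m \<in> N" "n \<in> N" for m n
    using sub that by (auto intro: subgroup.m_closed subgroup.m_inv_closed)
  have comm: "n \<otimes>\<^bsub>W\<^esub> (g \<otimes>\<^bsub>W\<^esub> inv\<^bsub>W\<^esub> n \<otimes>\<^bsub>W\<^esub> inv\<^bsub>W\<^esub> g) \<in> N" if "g \<in> carrier W" "n \<in> N" for g n
    using conj mult that by blast
  have swap: "(y, x, False) \<in> N" if "(x, y, False) \<in> N" for x y
    using conj[OF _ that, of "(\<one>, \<one>, True)"] N_carrier[OF that] by simp
  obtain n where n: "n \<in> N" "n \<noteq> \<one>\<^bsub>W\<^esub>"
    using N1 subgroup.one_closed[OF sub] by blast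
  have "\<exists>x y. (x, y, False) \<in> N \<and> x \<noteq> \<one>"
  proof -
    obtain x y e where xye: "n = (x, y, e)" by (cases n)
    have xy: "x \<in> carrier T" "y \<in> carrier T" using N_carrier n xye by blast+
    show ?thesis
    proof (cases e)
      case True
      \<comment> \<open>For an element carrying the swap, this commutator lies in the base group and
        has first coordinate \<open>inv a\<close>.\<close>
      have "n \<otimes>\<^bsub>W\<^esub> ((a, \<one>, False) \<otimes>\<^bsub>W\<^esub> inv\<^bsub>W\<^esub> n \<otimes>\<^bsub>W\<^esub> inv\<^bsub>W\<^esub> (a, \<one>, False)) \<in> N"
        using comm[of "(a, \<one>, False)" n] n by simp
      then have "(inv a, y \<otimes> a \<otimes> inv y, False) \<in> N"
        using xye xy True by (simp add: m_assoc[symmetric])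
      moreover have "inv a \<noteq> \<one>" using a1 by simp
      ultimately show ?thesis by blast
    next
      case False
      then show ?thesis using n xye swap by (cases "x = \<one>") auto
    qed
  qed
  then obtain x y where xy: "(x, y, False) \<in> N" "x \<noteq> \<one>" by blast
  note xyc = N_carrier[OF xy(1)]
  \<comment> \<open>As the centre is trivial, some \<open>z\<close> fails to commute with
    \<open>x\<close>; the commutator with \<open>(z, \<one>, False)\<close> then has trivial second
    and nontrivial first coordinate.\<close>
  obtain z where z: "z \<in> carrier T" "x \<otimes> z \<noteq> z \<otimes> x"
    using center_trivial xyc xy(2) by blast
  let ?N1 = "{w \<in> carrier T. (w, \<one>, False) \<in> N}"
  have "?N1 \<lhd> T"
    unfolding normal_inv_iff
  proof (intro conjI ballI)
    show "subgroup ?N1 T"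
    proof (rule subgroupI)
      show "?N1 \<noteq> {}" using subgroup.one_closed[OF sub] by auto
    next
      fix w assume "w \<in> ?N1"
      then show "inv w \<in> ?N1" using mult(2)[of "(w, \<one>, False)" "(w, \<one>, False)"] by simp
    next
      fix w w' assume "w \<in> ?N1" "w' \<in> ?N1"
      then show "w \<otimes> w' \<in> ?N1" using mult(1)[of "(w, \<one>, False)" "(w', \<one>, False)"] by simp
    qed auto
    fix g w assume "g \<in> carrier T" "w \<in> ?N1"
    then show "g \<otimes> w \<otimes> inv g \<in> ?N1" using conj[of "(g, \<one>, False)" "(w, \<one>, False)"] by simp
  qed
  moreover have "x \<otimes> (z \<otimes> inv x \<otimes> inv z) \<in> ?N1"
    using comm[of "(z, \<one>, False)" "(x, y, False)"] xy(1) xyc z by simp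
  moreover have "x \<otimes> (z \<otimes> inv x \<otimes> inv z) \<noteq> \<one>"
  proof
    assume "x \<otimes> (z \<otimes> inv x \<otimes> inv z) = \<one>"
    then have "x \<otimes> z \<otimes> inv (z \<otimes> x) = \<one>"
      using xyc z by (simp add: m_assoc inv_mult_group)
    then have "x \<otimes> z = z \<otimes> x"
      using xyc z by (metis inv_closed inv_equality inv_inv m_closed)
    then show False using z by simp
  qed
  ultimately have N1: "?N1 = carrier T"
    using simple by blast
  show ?thesis
  proof
    fix g assume "g \<in> H"
    then obtain p q where g: "g = (p, q, False)" "p \<in> carrier T" "q \<in> carrier T"
      by (auto simp: H_def)
    then have "(p, \<one>, False) \<in> N" "(\<one>, q, False) \<in> N"
      using N1 swap by blast+
    then have "(p, \<one>, False) \<otimes>\<^bsub>W\<^esub> (\<one>, q, False) \<in> N"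
      using mult by blast
    then show "g \<in> N" using g by simp
  qed
qed

lemma tau_conj:
  assumes "x \<in> carrier T" "y \<in> carrier T"
  shows "\<tau> \<otimes>\<^bsub>W\<^esub> (x, y, False) \<otimes>\<^bsub>W\<^esub> inv\<^bsub>W\<^esub> \<tau> = (y, t \<otimes> x \<otimes> t, False)"
    "inv\<^bsub>W\<^esub> \<tau> \<otimes>\<^bsub>W\<^esub> (x, y, False) \<otimes>\<^bsub>W\<^esub> \<tau> = (t \<otimes> y \<otimes> t, x, False)"
  using assms by (simp_all add: \<tau>_def)

lemma tat: "t \<otimes> a \<otimes> t = a \<otimes> a" and tbt: "t \<otimes> b \<otimes> t = b \<otimes> b"
  by (simp_all add: rules)

text \<open>Goursat's argument: the generated subgroup projects onto both factors and contains
  \<open>(\<one>, c, False)\<close> with \<open>c\<close> nontrivial. Such \<open>c\<close> form a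
  normal subgroup of \<open>T\<close>, so simplicity gives the second factor, and conjugation by
  \<open>\<tau>\<close> the first.\<close>

lemma generated: "generate W (insert \<tau> L) = carrier W"
proof -
  let ?M = "generate W (insert \<tau> L)"
  have tau_carrier: "\<tau> \<in> carrier W" by (simp add: \<tau>_def)
  have "insert \<tau> L \<subseteq> carrier W"
    using subgroup.subset[OF subgroup_L] tau_carrier by simp
  then have sub: "subgroup ?M W" by (rule W.generate_is_subgroup)
  have mult: "m \<otimes>\<^bsub>W\<^esub> n \<in> ?M" "inv\<^bsub>W\<^esub> n \<in> ?M" if "m \<in> ?M" "n \<in> ?M" for m n
    using sub that by (auto intro: subgroup.m_closed subgroup.m_inv_closed)
  have conj: "g \<otimes>\<^bsub>W\<^esub> n \<otimes>\<^bsub>W\<^esub> inv\<^bsub>W\<^esub> g \<in> ?M" if "g \<in> ?M" "n \<in> ?M" for g n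
    using mult that by blast
  have M_carrier: "x \<in> carrier T" "y \<in> carrier T" if "(x, y, e) \<in> ?M" for x y e
    using subgroup.mem_carrier[OF sub that] by simp_all
  have tau_M: "\<tau> \<in> ?M" and A_M: "(a, b, False) \<in> ?M"
    by (auto intro: generate.incl simp: L_eq)
  have tau_conj_M: "(y, t \<otimes> x \<otimes> t, False) \<in> ?M" if "(x, y, False) \<in> ?M" for x y
    using conj[OF tau_M that] tau_conj(1) M_carrier[OF that] by simp
  \<comment> \<open>With this conjugate the first coordinates include both \<open>a\<close> and
    \<open>b\<close>, which generate \<open>T\<close>.\<close>
  have B_M: "(b, a \<otimes> a, False) \<in> ?M"
    using tau_conj_M[OF A_M] by (simp add: tat)
  have fst_surj: "\<exists>y. (x, y, False) \<in> ?M" if "x \<in> carrier T" for x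
  proof -
    let ?S = "{x. \<exists>y. (x, y, False) \<in> ?M}"
    have "subgroup ?S T"
    proof (rule subgroupI)
      show "?S \<subseteq> carrier T" using M_carrier by blast
      show "?S \<noteq> {}" using A_M by blast
    next
      fix x assume "x \<in> ?S"
      then obtain y where "(x, y, False) \<in> ?M" by blast
      then have "(inv x, inv y, False) \<in> ?M"
        using mult(2)[of _ "(x, y, False)"] M_carrier by simp
      then show "inv x \<in> ?S" by blast
    next
      fix x x' assume "x \<in> ?S" "x' \<in> ?S"
      then obtain y y' where "(x, y, False) \<in> ?M" "(x', y', False) \<in> ?M" by blast
      then have "(x \<otimes> x', y \<otimes> y', False) \<in> ?M"
        using mult(1)[of "(x, y, False)" "(x', y', False)"] by simp
      then show "x \<otimes> x' \<in> ?S" by blast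
    qed
    then have "?S = carrier T"
      using generated_ab A_M B_M by blast
    then show ?thesis using that by blast
  qed
  have snd_surj: "\<exists>x. (x, y, False) \<in> ?M" if y: "y \<in> carrier T" for y
  proof -
    obtain z where "(t \<otimes> y \<otimes> t, z, False) \<in> ?M"
      using fst_surj[of "t \<otimes> y \<otimes> t"] y by auto
    then have "(z, t \<otimes> (t \<otimes> y \<otimes> t) \<otimes> t, False) \<in> ?M"
      by (rule tau_conj_M)
    then show ?thesis using y by (auto simp: rules)
  qed
  let ?u = "a \<otimes> b" and ?m = "b \<otimes> (a \<otimes> a)"
  have u_M: "(?u, ?m, False) \<in> ?M"
    using mult(1)[OF A_M B_M] by simp
  have pow_M: "(?u [^] n, ?m [^] n, False) \<in> ?M" for n :: nat
  proof (induction n)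
    case 0
    then show ?case using subgroup.one_closed[OF sub] by simp
  next
    case (Suc n)
    then show ?case using mult(1)[OF Suc u_M] by simp
  qed
  \<comment> \<open>Conjugating \<open>(?u, ?m, False)\<close> by \<open>(d, d', False)\<close> and
    dividing by its fourth power kills the first coordinate by \<open>d_conj\<close> and leaves a
    nontrivial second one by \<open>not_conj\<close>.\<close>
  obtain d' where d': "(d, d', False) \<in> ?M"
    using fst_surj[OF abt(4)] by blast
  note d'c = M_carrier(2)[OF d']
  let ?c = "d' \<otimes> ?m \<otimes> inv d' \<otimes> inv (?m [^] (4::nat))"
  have "(d \<otimes> ?u \<otimes> inv d \<otimes> inv (?u [^] (4::nat)), ?c, False) \<in> ?M"
    using mult(1)[OF conj[OF d' u_M] mult(2)[OF u_M pow_M[of 4]]] d'c by simp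
  then have c_M: "(\<one>, ?c, False) \<in> ?M"
    using d_conj by simp
  have c1: "?c \<noteq> \<one>"
    using not_conj[OF d'c] d'c
    by (metis abt(1,2) inv_closed inv_equality inv_inv m_closed nat_pow_closed)
  let ?N = "{y \<in> carrier T. (\<one>, y, False) \<in> ?M}"
  have "?N \<lhd> T"
    unfolding normal_inv_iff
  proof (intro conjI ballI)
    show "subgroup ?N T"
    proof (rule subgroupI)
      show "?N \<noteq> {}" using subgroup.one_closed[OF sub] by auto
    next
      fix w assume "w \<in> ?N"
      then show "inv w \<in> ?N" using mult(2)[of "(\<one>, w, False)" "(\<one>, w, False)"] by simp
    next
      fix w w' assume "w \<in> ?N" "w' \<in> ?N"
      then show "w \<otimes> w' \<in> ?N" using mult(1)[of "(\<one>, w, False)" "(\<one>, w', False)"] by simp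
    qed auto
    \<comment> \<open>Every \<open>g\<close> occurs as a second coordinate, so conjugation by
      \<open>g\<close> can be carried out inside the generated subgroup.\<close>
    fix g w assume g: "g \<in> carrier T" and w: "w \<in> ?N"
    obtain x where x: "(x, g, False) \<in> ?M" using snd_surj[OF g] by blast
    then show "g \<otimes> w \<otimes> inv g \<in> ?N"
      using conj[OF x, of "(\<one>, w, False)"] w g M_carrier(1)[OF x] by simp
  qed
  moreover have "?c \<in> ?N" using c_M M_carrier(2) by blast
  ultimately have "?N = carrier T" using simple c1 by blast
  then have snd_M: "(\<one>, y, False) \<in> ?M" if "y \<in> carrier T" for y
    using that by blast
  have fst_M: "(x, \<one>, False) \<in> ?M" if "x \<in> carrier T" for x
    using tau_conj_M[OF snd_M[OF that]] tt by simp
  have H_M: "(x, y, False) \<in> ?M" if "x \<in> carrier T" "y \<in> carrier T" for x y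
    using mult(1)[OF fst_M[OF that(1)] snd_M[OF that(2)]] that by simp
  have "(x, y, e) \<in> ?M" if xy: "x \<in> carrier T" "y \<in> carrier T" for x y e
  proof (cases e)
    case True
    have "(x, y \<otimes> t, False) \<otimes>\<^bsub>W\<^esub> \<tau> \<in> ?M"
      using mult(1)[OF H_M[of x "y \<otimes> t"] tau_M] xy by simp
    then show ?thesis using xy True tt by (simp add: \<tau>_def m_assoc)
  qed (use xy H_M in simp)
  then show ?thesis
    using subgroup.subset[OF sub] by auto
qed

section \<open>The coset graph of a generating triple\<close>

lemma cubic_coset_graph_W:
  assumes v: "\<And>g h. g \<in> carrier W \<Longrightarrow> h \<in> carrier W \<Longrightarrow> v g = v h \<longleftrightarrow> inv\<^bsub>W\<^esub> g \<otimes>\<^bsub>W\<^esub> h \<in> L"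
  shows "cubic_coset_graph W L v H \<tau> A S"
proof (intro cubic_coset_graph.intro index_two_coset_action.intro coset_action.intro
    cubic_coset_graph_axioms.intro index_two_coset_action_axioms.intro coset_action_axioms.intro)
  show "group W" by (rule group_wreath2)
  show "finite (carrier W)"
    using finite_T by (simp add: wreath2_def)
  show "subgroup L W" by (rule subgroup_L)
  show "v g = v h \<longleftrightarrow> inv\<^bsub>W\<^esub> g \<otimes>\<^bsub>W\<^esub> h \<in> L" if "g \<in> carrier W" "h \<in> carrier W" for g h
    using v that .
  show "H \<lhd> W" by (rule normal_H)
  show "L \<subseteq> H" by (auto simp: L_eq)
  show "\<tau> \<in> carrier W" "\<tau> \<notin> H" by (simp_all add: \<tau>_def)
  show "g \<otimes>\<^bsub>W\<^esub> inv\<^bsub>W\<^esub> \<tau> \<in> H" if "g \<in> carrier W" "g \<notin> H" for g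
    using that by (cases g) (auto simp: \<tau>_def)
  show "\<tau> \<otimes>\<^bsub>W\<^esub> \<tau> \<in> L"
    by (simp add: \<tau>_def L_eq)
  show "H \<subseteq> N" if "N \<lhd> W" "N \<noteq> {\<one>\<^bsub>W\<^esub>}" for N
    using normal_contains_H that .
  show "L \<noteq> H"
  proof
    assume "L = H"
    then have "(a, \<one>, False) \<in> L" by simp
    then show False using in_L_snd_one a1 by blast
  qed
  show "A \<otimes>\<^bsub>W\<^esub> A \<otimes>\<^bsub>W\<^esub> A = \<one>\<^bsub>W\<^esub>"
    "S \<otimes>\<^bsub>W\<^esub> A = A \<otimes>\<^bsub>W\<^esub> A \<otimes>\<^bsub>W\<^esub> S"
    by (simp_all add: A_def S_def aaa bbb tt ta tb)
  show "L = {\<one>\<^bsub>W\<^esub>, A, A \<otimes>\<^bsub>W\<^esub> A, S, A \<otimes>\<^bsub>W\<^esub> S, A \<otimes>\<^bsub>W\<^esub> A \<otimes>\<^bsub>W\<^esub> S}"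
    by (rule L_def)
  show "inv\<^bsub>W\<^esub> \<tau> \<otimes>\<^bsub>W\<^esub> S \<otimes>\<^bsub>W\<^esub> \<tau> \<in> L"
    unfolding S_def using tau_conj(2)[of t t] tt by (simp add: L_eq)
  show "inv\<^bsub>W\<^esub> \<tau> \<otimes>\<^bsub>W\<^esub> A \<otimes>\<^bsub>W\<^esub> \<tau> \<notin> L"
    unfolding A_def tau_conj(2)[OF abt(1,2)] using in_L_snd a_notin by blast
  show "generate W (insert \<tau> L) = carrier W" by (rule generated)
qed

lemma normal_K: "K \<lhd> W\<lparr>carrier := H\<rparr>"
proof -
  have sub: "subgroup H W" using normal_H by (rule normal_imp_subgroup)
  interpret WH: group "W\<lparr>carrier := H\<rparr>"
    using W.subgroup_imp_group[OF sub] .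
  have inv_H: "inv\<^bsub>W\<lparr>carrier := H\<rparr>\<^esub> h = inv\<^bsub>W\<^esub> h" if "h \<in> H" for h
    using W.m_inv_consistent[OF sub that] .
  show ?thesis
    unfolding WH.normal_inv_iff
  proof (intro conjI ballI)
    show "subgroup K (W\<lparr>carrier := H\<rparr>)"
      by (rule WH.subgroupI) (auto simp: K_def inv_H)
    fix g k assume "g \<in> carrier (W\<lparr>carrier := H\<rparr>)" "k \<in> K"
    then show "g \<otimes>\<^bsub>W\<lparr>carrier := H\<rparr>\<^esub> k \<otimes>\<^bsub>W\<lparr>carrier := H\<rparr>\<^esub> inv\<^bsub>W\<lparr>carrier := H\<rparr>\<^esub> g \<in> K"
      by (cases g) (auto simp: K_def inv_H)
  qed
qed

text \<open>\<open>L\<close> meets \<open>K\<close> trivially, so the elements of the first factor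
  name distinct vertices. The resulting bound forces graphs from larger groups to be larger.\<close>

lemma ex_cubic_graph:
  "\<exists>\<Gamma> :: nat pair_pre_digraph. card (carrier T) \<le> card (pverts \<Gamma>) \<and>
    pair_graph \<Gamma> \<and> connected (with_proj \<Gamma>) \<and> regular_of_valency \<Gamma> 3 \<and>
    (\<exists>A B. bipartition \<Gamma> A B \<and>
      (\<exists>G. subgroup G (GraphAutoGroup \<Gamma>) \<and>
        s_arc_transitive \<Gamma> G 2 \<and>
        biquasiprimitive (pverts \<Gamma>) G \<and>
        \<not> quasiprimitive_on (even_subgroup \<Gamma> G) A \<and>
        \<not> quasiprimitive_on (even_subgroup \<Gamma> G) B))"
proof -
  have finite_W: "finite (carrier W)"
    using finite_T by (simp add: wreath2_def)
  obtain v :: "'a \<times> 'a \<times> bool \<Rightarrow> nat" where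
    v: "\<And>g h. g \<in> carrier W \<Longrightarrow> h \<in> carrier W \<Longrightarrow> v g = v h \<longleftrightarrow> inv\<^bsub>W\<^esub> g \<otimes>\<^bsub>W\<^esub> h \<in> L"
    using W.ex_coset_labelling[OF finite_W subgroup_L] by blast
  interpret C: cubic_coset_graph W L v H \<tau> A S
    using v by (rule cubic_coset_graph_W)
  have "inj_on (\<lambda>x. v (x, \<one>, False)) (carrier T)"
  proof (rule inj_onI)
    fix x y assume xy: "x \<in> carrier T" "y \<in> carrier T" "v (x, \<one>, False) = v (y, \<one>, False)"
    then have "(inv x \<otimes> y, \<one>, False) \<in> L"
      using v[of "(x, \<one>, False)" "(y, \<one>, False)"] by simp
    then have "inv x \<otimes> y = \<one>" by (rule in_L_snd_one)
    then show "x = y" using xy by (metis inv_closed inv_equality inv_inv)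
  qed
  moreover have "(\<lambda>x. v (x, \<one>, False)) ` carrier T \<subseteq> C.V"
    by auto
  ultimately have "card (carrier T) \<le> card (pverts C.graph)"
    using card_inj_on_le C.finite_V by simp
  moreover have "\<exists>k\<in>K. k \<notin> L"
    using in_L_snd_one a1 by (intro bexI[of _ "(a, \<one>, False)"]) (auto simp: K_def)
  moreover have "\<exists>k\<in>K. inv\<^bsub>W\<^esub> \<tau> \<otimes>\<^bsub>W\<^esub> k \<otimes>\<^bsub>W\<^esub> \<tau> \<notin> L"
    using in_L_snd[of _ a] a_notin tau_conj(2)[OF abt(1) one_closed]
    by (intro bexI[of _ "(a, \<one>, False)"]) (auto simp: K_def)
  \<comment> \<open>Factors from \<open>K\<close> do not touch the second coordinate, and
    \<open>a\<close> is not a second coordinate of \<open>L\<close>. For the other half, conjugation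
    by \<open>\<tau>\<close> puts \<open>t \<otimes> (b \<otimes> b) \<otimes> t = b\<close> in
    first place, where \<open>L\<close> does not have it.\<close>
  moreover have "(\<one>, a, False) \<in> H" "(\<one>, b \<otimes> b, False) \<in> H"
    by simp_all
  moreover have "inv\<^bsub>W\<^esub> k \<otimes>\<^bsub>W\<^esub> (\<one>, a, False) \<notin> L" if "k \<in> K" for k
    using that in_L_snd[of _ a] a_notin by (auto simp: K_def)
  moreover have "inv\<^bsub>W\<^esub> \<tau> \<otimes>\<^bsub>W\<^esub> (inv\<^bsub>W\<^esub> k \<otimes>\<^bsub>W\<^esub> (\<one>, b \<otimes> b, False)) \<otimes>\<^bsub>W\<^esub> \<tau> \<notin> L" if k: "k \<in> K" for k
  proof -
    obtain x where x: "k = (x, \<one>, False)" "x \<in> carrier T"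
      using k by (auto simp: K_def)
    have "t \<otimes> (b \<otimes> b) \<otimes> t = b"
      by (simp add: rules)
    then show ?thesis
      using x tau_conj(2)[of "inv x" "b \<otimes> b"] in_L_fst[of b] b_notin by auto
  qed
  ultimately show ?thesis
    using C.graph_properties[OF normal_K] by blast
qed

end

section \<open>The groups PSL(2, p)\<close>

text \<open>Integer quadruples compared modulo \<open>p\<close> stand for matrices over the
  residues, so matrix identities become integer algebra and divisibility.\<close>

type_synonym mat2 = "int \<times> int \<times> int \<times> int"

fun mm :: "mat2 \<Rightarrow> mat2 \<Rightarrow> mat2" (infixl "\<star>" 70) where
  "(x, y, z, w) \<star> (x', y', z', w') = (x * x' + y * z', x * y' + y * w', z * x' + w * z', z * y' + w * w')"

fun adj :: "mat2 \<Rightarrow> mat2" where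
  "adj (x, y, z, w) = (w, - y, - z, x)"

fun det2 :: "mat2 \<Rightarrow> int" where
  "det2 (x, y, z, w) = x * w - y * z"

fun tr2 :: "mat2 \<Rightarrow> int" where
  "tr2 (x, y, z, w) = x + w"

fun smult2 :: "int \<Rightarrow> mat2 \<Rightarrow> mat2" where
  "smult2 s (x, y, z, w) = (s * x, s * y, s * z, s * w)"

fun cong2 :: "int \<Rightarrow> mat2 \<Rightarrow> mat2 \<Rightarrow> bool" where
  "cong2 p (x, y, z, w) (x', y', z', w') \<longleftrightarrow>
     [x = x'] (mod p) \<and> [y = y'] (mod p) \<and> [z = z'] (mod p) \<and> [w = w'] (mod p)"

definition upper :: "int \<Rightarrow> mat2" where "upper k = (1, k, 0, 1)"
definition lower :: "int \<Rightarrow> mat2" where "lower k = (1, 0, k, 1)"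

lemma mm_assoc: "L \<star> M \<star> N = L \<star> (M \<star> N)"
  by (cases L; cases M; cases N) (simp add: algebra_simps)

lemma det2_mm: "det2 (M \<star> N) = det2 M * det2 N"
  by (cases M; cases N) (simp add: algebra_simps)

lemma det2_adj [simp]: "det2 (adj M) = det2 M"
  by (cases M) simp

lemma adj_mm: "adj M \<star> M = smult2 (det2 M) (1, 0, 0, 1)"
  by (cases M) (simp add: algebra_simps)

lemma cong2_refl [simp]: "cong2 p M M"
  by (cases M) simp

lemma cong2_sym: "cong2 p M N \<Longrightarrow> cong2 p N M"
  by (cases M; cases N) (simp add: cong_sym)

lemma cong2_trans: "cong2 p L M \<Longrightarrow> cong2 p M N \<Longrightarrow> cong2 p L N"
  by (cases L; cases M; cases N) (auto intro: cong_trans)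

lemma cong2_mm: "cong2 p M M' \<Longrightarrow> cong2 p N N' \<Longrightarrow> cong2 p (M \<star> N) (M' \<star> N')"
  by (cases M; cases N; cases M'; cases N') (auto intro!: cong_add cong_mult)

lemma cong2_smult2: "cong2 p M N \<Longrightarrow> cong2 p (smult2 s M) (smult2 s N)"
  by (cases M; cases N) (auto intro!: cong_mult)

lemma cong2_det2: "cong2 p M N \<Longrightarrow> [det2 M = det2 N] (mod p)"
  by (cases M; cases N) (auto intro!: cong_diff cong_mult)

lemma cong2_tr2: "cong2 p M N \<Longrightarrow> [tr2 M = tr2 N] (mod p)"
  by (cases M; cases N) (auto intro!: cong_add)

lemma smult2_smult2 [simp]: "smult2 s (smult2 r M) = smult2 (s * r) M"
  by (cases M) simp

lemma smult2_one [simp]: "smult2 1 M = M"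
  by (cases M) simp

lemma smult2_mm: "smult2 s M \<star> smult2 r N = smult2 (s * r) (M \<star> N)"
  by (cases M; cases N) (simp add: algebra_simps)

lemma det2_smult2: "det2 (smult2 s M) = s * s * det2 M"
  by (cases M) (simp add: algebra_simps)

text \<open>Equality in the quotient by the scalars 1 and -1.\<close>

definition pm_cong :: "int \<Rightarrow> mat2 \<Rightarrow> mat2 \<Rightarrow> bool" where
  "pm_cong p M N \<longleftrightarrow> (\<exists>s\<in>{1, -1}. cong2 p M (smult2 s N))"

lemma pm_cong_refl [simp]: "pm_cong p M M"
  by (auto simp: pm_cong_def)

lemma cong2_imp_pm_cong: "cong2 p M N \<Longrightarrow> pm_cong p M N"
  by (auto simp: pm_cong_def)

lemma pm_cong_sym: assumes "pm_cong p M N" shows "pm_cong p N M"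
proof -
  obtain s :: int where s: "s \<in> {1, -1}" "cong2 p M (smult2 s N)"
    using assms unfolding pm_cong_def by blast
  then have "cong2 p (smult2 s M) (smult2 s (smult2 s N))"
    by (intro cong2_smult2)
  then have "cong2 p (smult2 s M) N"
    using s by auto
  then show ?thesis
    using s(1) cong2_sym unfolding pm_cong_def by blast
qed

lemma pm_cong_trans: assumes "pm_cong p L M" "pm_cong p M N" shows "pm_cong p L N"
proof -
  obtain s r :: int where s: "s \<in> {1, -1}" "cong2 p L (smult2 s M)"
    and r: "r \<in> {1, -1}" "cong2 p M (smult2 r N)"
    using assms unfolding pm_cong_def by blast
  have "cong2 p L (smult2 (s * r) N)"
    using cong2_trans[OF s(2) cong2_smult2[OF r(2), of s]] by simp
  moreover have "s * r \<in> {1, -1}" using s(1) r(1) by auto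
  ultimately show ?thesis unfolding pm_cong_def by blast
qed

lemma pm_cong_mm:
  assumes "pm_cong p M M'" "pm_cong p N N'" shows "pm_cong p (M \<star> N) (M' \<star> N')"
proof -
  obtain s r :: int where s: "s \<in> {1, -1}" "cong2 p M (smult2 s M')"
    and r: "r \<in> {1, -1}" "cong2 p N (smult2 r N')"
    using assms unfolding pm_cong_def by blast
  have "cong2 p (M \<star> N) (smult2 (s * r) (M' \<star> N'))"
    using cong2_mm[OF s(2) r(2)] by (simp add: smult2_mm)
  moreover have "s * r \<in> {1, -1}" using s(1) r(1) by auto
  ultimately show ?thesis unfolding pm_cong_def by blast
qed

section \<open>Determinant one and the quotient group\<close>

definition SL2 :: "int \<Rightarrow> mat2 set" where
  "SL2 p = {M. [det2 M = 1] (mod p)}"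

lemma SL2_mm: "M \<in> SL2 p \<Longrightarrow> N \<in> SL2 p \<Longrightarrow> M \<star> N \<in> SL2 p"
  using cong_mult[of "det2 M" 1 p "det2 N" 1] by (simp add: SL2_def det2_mm)

lemma SL2_pm_cong: assumes "pm_cong p M N" shows "M \<in> SL2 p \<longleftrightarrow> N \<in> SL2 p"
proof -
  obtain s :: int where s: "s \<in> {1, -1}" "cong2 p M (smult2 s N)"
    using assms unfolding pm_cong_def by blast
  then have "[det2 M = s * s * det2 N] (mod p)"
    using cong2_det2 det2_smult2 by metis
  then have "[det2 M = det2 N] (mod p)"
    using s(1) by auto
  then show ?thesis
    unfolding SL2_def by (auto intro: cong_trans cong_sym)
qed

lemma SL2_adj [simp]: "adj M \<in> SL2 p \<longleftrightarrow> M \<in> SL2 p"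
  by (simp add: SL2_def)

lemma adj_mm_cong: assumes "M \<in> SL2 p" shows "pm_cong p (adj M \<star> M) (1, 0, 0, 1)"
proof -
  have "cong2 p (smult2 (det2 M) (1, 0, 0, 1)) (1, 0, 0, 1)"
    using assms by (simp add: SL2_def)
  then show ?thesis
    unfolding adj_mm by (rule cong2_imp_pm_cong)
qed

definition pcls :: "int \<Rightarrow> mat2 \<Rightarrow> mat2 set" where
  "pcls p M = {N. pm_cong p M N}"

lemma pcls_eq_iff: "pcls p M = pcls p N \<longleftrightarrow> pm_cong p M N"
  unfolding pcls_def using pm_cong_refl pm_cong_sym pm_cong_trans by blast

text \<open>An element of \<open>PSL(2, p)\<close> is the set of all integer matrices congruent modulo \<open>p\<close> to \<open>M\<close> or
  \<open>-M\<close>; a matrix is given by its entries in row order.\<close>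

definition PSL2 :: "int \<Rightarrow> mat2 set monoid" where
  "PSL2 p = \<lparr>carrier = pcls p ` SL2 p,
     monoid.mult = (\<lambda>X Y. pcls p ((SOME M. M \<in> X) \<star> (SOME N. N \<in> Y))),
     one = pcls p (1, 0, 0, 1)\<rparr>"

lemma carrier_PSL2: "carrier (PSL2 p) = pcls p ` SL2 p"
  and one_PSL2: "\<one>\<^bsub>PSL2 p\<^esub> = pcls p (1, 0, 0, 1)"
  by (simp_all add: PSL2_def)

lemma mult_PSL2 [simp]: "pcls p M \<otimes>\<^bsub>PSL2 p\<^esub> pcls p N = pcls p (M \<star> N)"
proof -
  have "pm_cong p M (SOME M'. M' \<in> pcls p M)" for M
    by (rule someI2[of _ M]) (simp_all add: pcls_def)
  then show ?thesis
    by (simp add: PSL2_def pcls_eq_iff pm_cong_mm pm_cong_sym)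
qed

lemma pcls_in_PSL2 [simp]: "pcls p M \<in> carrier (PSL2 p) \<longleftrightarrow> M \<in> SL2 p"
  unfolding carrier_PSL2 image_iff pcls_eq_iff using SL2_pm_cong pm_cong_refl by blast

lemma one_SL2 [simp]: "(1, 0, 0, 1) \<in> SL2 p"
  by (simp add: SL2_def)

lemma group_PSL2: "group (PSL2 p)"
proof (rule groupI)
  fix X assume "X \<in> carrier (PSL2 p)"
  then obtain M where M: "M \<in> SL2 p" "X = pcls p M"
    by (auto simp: carrier_PSL2)
  then show "\<exists>Y\<in>carrier (PSL2 p). Y \<otimes>\<^bsub>PSL2 p\<^esub> X = \<one>\<^bsub>PSL2 p\<^esub>"
    using adj_mm_cong by (intro bexI[of _ "pcls p (adj M)"]) (auto simp: one_PSL2 pcls_eq_iff)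
  show "\<one>\<^bsub>PSL2 p\<^esub> \<otimes>\<^bsub>PSL2 p\<^esub> X = X"
    using M by (cases M) (simp add: one_PSL2)
next
  fix X Y Z assume "X \<in> carrier (PSL2 p)" "Y \<in> carrier (PSL2 p)" "Z \<in> carrier (PSL2 p)"
  then obtain L M N where "X = pcls p L" "Y = pcls p M" "Z = pcls p N"
    unfolding carrier_PSL2 by blast
  then show "X \<otimes>\<^bsub>PSL2 p\<^esub> Y \<otimes>\<^bsub>PSL2 p\<^esub> Z = X \<otimes>\<^bsub>PSL2 p\<^esub> (Y \<otimes>\<^bsub>PSL2 p\<^esub> Z)"
    by (simp add: mm_assoc)
next
  fix X Y assume "X \<in> carrier (PSL2 p)" "Y \<in> carrier (PSL2 p)"
  then obtain M N where "X = pcls p M" "Y = pcls p N" "M \<in> SL2 p" "N \<in> SL2 p"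
    unfolding carrier_PSL2 by blast
  then show "X \<otimes>\<^bsub>PSL2 p\<^esub> Y \<in> carrier (PSL2 p)"
    by (simp add: SL2_mm)
qed (simp add: one_PSL2)

lemma inv_PSL2 [simp]: "M \<in> SL2 p \<Longrightarrow> inv\<^bsub>PSL2 p\<^esub> (pcls p M) = pcls p (adj M)"
  using adj_mm_cong
  by (intro group.inv_equality[OF group_PSL2]) (simp_all add: one_PSL2 pcls_eq_iff)

lemma finite_PSL2: assumes "0 < p" shows "finite (carrier (PSL2 p))"
proof (rule finite_subset)
  let ?I = "{0..<p}"
  show "carrier (PSL2 p) \<subseteq> pcls p ` (?I \<times> ?I \<times> ?I \<times> ?I)"
  proof
    fix X assume "X \<in> carrier (PSL2 p)"
    then obtain x y z w where X: "X = pcls p (x, y, z, w)"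
      by (auto simp: carrier_PSL2)
    have "cong2 p (x, y, z, w) (x mod p, y mod p, z mod p, w mod p)"
      by (simp add: cong_def)
    then have "X = pcls p (x mod p, y mod p, z mod p, w mod p)"
      unfolding X pcls_eq_iff by (rule cong2_imp_pm_cong)
    then show "X \<in> pcls p ` (?I \<times> ?I \<times> ?I \<times> ?I)"
      using assms by (intro image_eqI) auto
  qed
qed simp

lemma upper_SL2 [simp]: "upper k \<in> SL2 p" and lower_SL2 [simp]: "lower k \<in> SL2 p"
  by (simp_all add: SL2_def upper_def lower_def)

text \<open>The classes of \<open>upper k\<close> for \<open>0 \<le> k < p\<close> are distinct: a
  sign -1 would make \<open>p\<close> divide 2.\<close>

lemma card_PSL2: assumes "2 < p" shows "p \<le> int (card (carrier (PSL2 p)))"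
proof -
  have "inj_on (\<lambda>k. pcls p (upper k)) {0..<p}"
  proof (rule inj_onI)
    fix k l assume kl: "k \<in> {0..<p}" "l \<in> {0..<p}" "pcls p (upper k) = pcls p (upper l)"
    then obtain s where s: "s \<in> {1, -1}" "cong2 p (upper k) (smult2 s (upper l))"
      unfolding pcls_eq_iff pm_cong_def by blast
    have "s \<noteq> -1"
    proof
      assume "s = -1"
      then have "[1 = -1] (mod p)" using s by (simp add: upper_def)
      then have "p dvd 2" by (simp add: cong_iff_dvd_diff)
      then show False using assms zdvd_imp_le by fastforce
    qed
    then have "[k = l] (mod p)" using s by (auto simp: upper_def)
    then show "k = l" using kl by (auto simp: cong_def)
  qed
  then have "card {0..<p} \<le> card (carrier (PSL2 p))"
    by (rule card_inj_on_le) (use finite_PSL2 assms in auto)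
  then show ?thesis by simp
qed

section \<open>Generation by transvections and simplicity\<close>

locale prime_mod =
  fixes p :: int
  assumes prime_p: "prime p"
begin

lemma inverse_mod: assumes "\<not> p dvd x" obtains y where "[x * y = 1] (mod p)"
  using assms prime_p cong_solve_coprime_int[of x p] prime_imp_coprime[of p x]
  by (metis coprime_commute)

text \<open>Transvections of one kind form a copy of the residues modulo \<open>p\<close>, which any
  nonzero \<open>c\<close> generates. Phrased for a predicate on matrices, this applies to the
  preimage of any subgroup of \<open>PSL2 p\<close>.\<close>

lemma lower_multiples:
  assumes mult: "\<And>M N. Q M \<Longrightarrow> Q N \<Longrightarrow> Q (M \<star> N)"
    and resp: "\<And>M N. Q M \<Longrightarrow> pm_cong p M N \<Longrightarrow> Q N"
    and c: "\<not> p dvd c"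
  shows "Q (lower c) \<Longrightarrow> Q (lower k)" "Q (upper c) \<Longrightarrow> Q (upper k)"
proof -
  obtain c' where c': "[c * c' = 1] (mod p)" using c inverse_mod by blast
  \<comment> \<open>\<open>n + 1\<close> is a multiplier congruent to \<open>k * c'\<close>. It is
    positive because the induction below starts at \<open>c\<close> itself and not at the
    identity.\<close>
  define n where "n = nat ((k * c' - 1) mod p)"
  have "int n = (k * c' - 1) mod p"
    using prime_p by (simp add: n_def prime_gt_0_int)
  then have "[int n = k * c' - 1] (mod p)" by simp
  then have "[(int n + 1) * c = (k * c' - 1 + 1) * c] (mod p)"
    by (intro cong_mult cong_add) auto
  also have "(k * c' - 1 + 1) * c = k * (c * c')" by simp
  also have "[k * (c * c') = k * 1] (mod p)"
    using c' by (intro cong_mult) auto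
  finally have n: "[(int n + 1) * c = k] (mod p)" by simp
  show "Q (lower k)" if Q: "Q (lower c)"
  proof -
    have "Q (lower ((int m + 1) * c))" for m
    proof (induction m)
      case (Suc m)
      from mult[OF this Q] show ?case
        by (simp add: lower_def algebra_simps)
    qed (use Q in simp)
    then show ?thesis
      by (rule resp[OF _ cong2_imp_pm_cong]) (use n in \<open>simp add: lower_def\<close>)
  qed
  show "Q (upper k)" if Q: "Q (upper c)"
  proof -
    have "Q (upper ((int m + 1) * c))" for m
    proof (induction m)
      case (Suc m)
      from mult[OF this Q] show ?case
        by (simp add: upper_def algebra_simps)
    qed (use Q in simp)
    then show ?thesis
      by (rule resp[OF _ cong2_imp_pm_cong]) (use n in \<open>simp add: upper_def\<close>)
  qed
qed

text \<open>Gaussian elimination: a matrix with invertible lower left entry is a product upper,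
  lower, upper; otherwise adding the first row to the second makes that entry invertible.\<close>

lemma SL2_generated:
  assumes mult: "\<And>M N. Q M \<Longrightarrow> Q N \<Longrightarrow> Q (M \<star> N)"
    and resp: "\<And>M N. Q M \<Longrightarrow> pm_cong p M N \<Longrightarrow> Q N"
    and lower: "\<And>k. Q (lower k)" and upper: "\<And>k. Q (upper k)"
    and M: "M \<in> SL2 p"
  shows "Q M"
proof -
  have nonzero: "Q (x, y, z, w)" if "(x, y, z, w) \<in> SL2 p" and z: "\<not> p dvd z" for x y z w
  proof -
    obtain z' where z': "p dvd z * z' - 1"
      using inverse_mod[OF z] by (auto simp: cong_iff_dvd_diff)
    have det: "p dvd x * w - y * z - 1"
      using that by (simp add: SL2_def cong_iff_dvd_diff)
    \<comment> \<open>These solve \<open>1 + ?\<alpha> * z = x\<close> and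
      \<open>1 + z * ?\<beta> = w\<close> modulo \<open>p\<close>; the determinant then forces the
      upper right entry.\<close>
    let ?\<alpha> = "(x - 1) * z'" and ?\<beta> = "(w - 1) * z'"
    have "Q (upper ?\<alpha> \<star> lower z \<star> upper ?\<beta>)"
      using mult lower upper by blast
    moreover have "cong2 p (upper ?\<alpha> \<star> lower z \<star> upper ?\<beta>) (x, y, z, w)"
    proof -
      have "1 + ?\<alpha> * z - x = (x - 1) * (z * z' - 1)" by (simp add: algebra_simps)
      moreover have "z * ?\<beta> + 1 - w = (w - 1) * (z * z' - 1)" by (simp add: algebra_simps)
      moreover have "(1 + ?\<alpha> * z) * ?\<beta> + ?\<alpha> - y =
          (y + (x - 1) * z' * (w - 1)) * (z * z' - 1) + z' * (x * w - y * z - 1)"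
        by (simp add: algebra_simps)
      ultimately show ?thesis
        using z' det by (simp add: upper_def lower_def cong_iff_dvd_diff)
    qed
    ultimately show ?thesis
      using resp cong2_imp_pm_cong by blast
  qed
  obtain x y z w where xyzw: "M = (x, y, z, w)" by (cases M)
  show ?thesis
  proof (cases "p dvd z")
    case True
    have "lower 1 \<star> M \<in> SL2 p" using M by (simp add: SL2_mm)
    moreover have "\<not> p dvd x + z"
    proof
      assume "p dvd x + z"
      then have "p dvd x * w - y * z"
        using True by (metis dvd_add_left_iff dvd_diff dvd_mult dvd_mult2)
      moreover have "p dvd x * w - y * z - 1"
        using M by (simp add: xyzw SL2_def cong_iff_dvd_diff)
      ultimately have "p dvd 1" by (metis dvd_diff_commute dvd_diff diff_diff_eq2 add_diff_cancel_left')
      then show False using prime_p not_prime_unit by blast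
    qed
    ultimately have "Q (lower 1 \<star> M)"
      using nonzero[of x y "x + z" "y + w"] by (simp add: xyzw lower_def)
    then have "Q (lower (- 1) \<star> (lower 1 \<star> M))"
      using mult lower by blast
    then show ?thesis by (simp add: xyzw lower_def)
  qed (use nonzero M xyzw in blast)
qed

end

text \<open>A nontrivial element of \<open>N\<close> is conjugated until its upper left entry
  vanishes and its lower left one does not. Commutators with a diagonal matrix and then with a
  transvection stay in \<open>N\<close> and give a nontrivial lower transvection; its powers and
  their conjugates include all transvections, which generate.\<close>

lemma (in prime_mod) PSL2_simple:
  assumes p5: "5 < p" and N: "N \<lhd> PSL2 p" and N1: "N \<noteq> {\<one>\<^bsub>PSL2 p\<^esub>}"
  shows "N = carrier (PSL2 p)"
proof -
  have sub: "subgroup N (PSL2 p)" using N by (rule normal_imp_subgroup)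
  define Q where "Q M \<longleftrightarrow> pcls p M \<in> N" for M
  have SL: "M \<in> SL2 p" if "Q M" for M
    using that subgroup.mem_carrier[OF sub] unfolding Q_def by fastforce
  have mult: "Q (M \<star> M')" if "Q M" "Q M'" for M M'
    using subgroup.m_closed[OF sub] that unfolding Q_def by fastforce
  have resp: "Q M'" if "Q M" "pm_cong p M M'" for M M'
    using that pcls_eq_iff unfolding Q_def by metis
  have congQ: "Q M'" if "Q M" "cong2 p M M'" for M M'
    using resp that cong2_imp_pm_cong by blast
  have adjQ: "Q (adj M)" if "Q M" for M
    using subgroup.m_inv_closed[OF sub] that SL[OF that] unfolding Q_def by fastforce
  have conj: "Q (g \<star> M \<star> adj g)" if "Q M" "g \<in> SL2 p" for g M
    using normal.inv_op_closed2[OF N, of "pcls p g" "pcls p M"] that by (simp add: Q_def)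
  have not_dvd: "\<not> p dvd k" if "0 < k" "k \<le> 5" for k
    using zdvd_imp_le[of p k] that p5 by auto
  have "\<exists>x y z w. Q (x, y, z, w) \<and> \<not> p dvd z"
  proof -
    obtain X where X: "X \<in> N" "X \<noteq> \<one>\<^bsub>PSL2 p\<^esub>"
      using N1 subgroup.one_closed[OF sub] by blast
    then obtain x y z w where xyzw: "X = pcls p (x, y, z, w)" "(x, y, z, w) \<in> SL2 p"
      using subgroup.mem_carrier[OF sub X(1)] by (auto simp: carrier_PSL2)
    have Q: "Q (x, y, z, w)" using X xyzw by (simp add: Q_def)
    \<comment> \<open>Conjugation by a quarter turn moves \<open>y\<close> to the lower left up to
      sign. For a diagonal matrix, conjugation by \<open>lower 1\<close> produces
      \<open>x - w\<close> there modulo \<open>p\<close>, nonzero unless the matrix is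
      scalar.\<close>
    consider "\<not> p dvd z" | "\<not> p dvd y" | "p dvd z" "p dvd y" by blast
    then show ?thesis
    proof cases
      case 1
      then show ?thesis using Q by blast
    next
      case 2
      have "(0, -1, 1, 0) \<in> SL2 p" by (simp add: SL2_def)
      from conj[OF Q this] have "Q (w, - z, - y, x)" by simp
      then show ?thesis using 2 by (metis dvd_minus_iff)
    next
      case 3
      have "\<not> p dvd x - w"
      proof
        assume xw: "p dvd x - w"
        have det: "p dvd x * w - y * z - 1"
          using xyzw by (simp add: SL2_def cong_iff_dvd_diff)
        \<comment> \<open>A scalar matrix of determinant one has \<open>x * x\<close> congruent to
          1, so \<open>x\<close> is 1 or -1 modulo the prime and the class is trivial.\<close>
        have "(x - 1) * (x + 1) = x * (x - w) + (x * w - y * z - 1) + y * z"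
          by (simp add: algebra_simps)
        then have "p dvd (x - 1) * (x + 1)"
          using xw det 3 by (simp only: dvd_add dvd_mult)
        then consider "p dvd x - 1" | "p dvd x + 1"
          using prime_p prime_dvd_mult_iff by blast
        then have "\<exists>s\<in>{1, -1}. p dvd x - s"
          by cases auto
        then obtain s where s: "s \<in> {1, -1}" "p dvd x - s" by blast
        moreover have "p dvd w - s"
          using dvd_diff[OF s(2) xw] by simp
        ultimately have "cong2 p (x, y, z, w) (smult2 s (1, 0, 0, 1))"
          using 3 by (simp add: cong_iff_dvd_diff)
        then have "pm_cong p (x, y, z, w) (1, 0, 0, 1)"
          using s(1) unfolding pm_cong_def by blast
        then show False
          using X(2) xyzw by (simp add: one_PSL2 pcls_eq_iff)
      qed
      moreover have "x + z - (y + w) = (x - w) + (z - y)" by simp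
      ultimately have "\<not> p dvd x + z - (y + w)"
        using 3 by (metis dvd_add_left_iff dvd_diff)
      moreover have "Q (x - y, y, x + z - (y + w), y + w)"
        using conj[OF Q lower_SL2[of 1]] by (simp add: lower_def algebra_simps)
      ultimately show ?thesis by blast
    qed
  qed
  then obtain x y z w where Q: "Q (x, y, z, w)" and z: "\<not> p dvd z" by blast
  obtain z' where z': "p dvd z * z' - 1"
    using inverse_mod[OF z] by (auto simp: cong_iff_dvd_diff)
  obtain h where h: "p dvd 2 * h - 1"
    using inverse_mod[of 2] not_dvd[of 2] by (auto simp: cong_iff_dvd_diff)
  \<comment> \<open>Conjugation by \<open>upper \<alpha>\<close> makes the upper left entry
    \<open>x + \<alpha> * z\<close>, which this choice annihilates modulo \<open>p\<close>.\<close>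
  define \<alpha> where "\<alpha> = - x * z'"
  define x1 y1 w1 where "x1 = x + \<alpha> * z" and "y1 = y + \<alpha> * w - \<alpha> * (x + \<alpha> * z)" and "w1 = w - \<alpha> * z"
  have Q1: "Q (x1, y1, z, w1)"
    using conj[OF Q upper_SL2[of \<alpha>]] by (simp add: upper_def x1_def y1_def w1_def algebra_simps)
  have x1: "p dvd x1"
  proof -
    have "x1 = - x * (z * z' - 1)" by (simp add: x1_def \<alpha>_def algebra_simps)
    then show ?thesis using z' by simp
  qed
  have det1: "p dvd x1 * w1 - y1 * z - 1"
    using SL[OF Q1] by (simp add: SL2_def cong_iff_dvd_diff)
  \<comment> \<open>Because \<open>x1\<close> vanishes modulo \<open>p\<close>, the commutator with
    this diagonal matrix is lower triangular, with diagonal entries 4 and its inverse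
    \<open>h * h\<close>.\<close>
  have "(2, 0, 0, h) \<in> SL2 p"
    using h by (simp add: SL2_def cong_iff_dvd_diff)
  from mult[OF conj[OF Q1 this] adjQ[OF Q1]]
  have C: "Q (4, 0, (h * h - 1) * z * w1, h * h)"
  proof (rule congQ)
    let ?A = "2 * h - 1" and ?B = "x1 * w1 - y1 * z - 1"
    show "cong2 p ((2, 0, 0, h) \<star> (x1, y1, z, w1) \<star> adj (2, 0, 0, h) \<star> adj (x1, y1, z, w1))
      (4, 0, (h * h - 1) * z * w1, h * h)"
    proof -
      have "2 * x1 * h * w1 - 4 * y1 * z - 4 = x1 * (w1 * (2 * h) - 4 * w1) + 4 * ?B"
        by (simp add: algebra_simps)
      then have "p dvd 2 * x1 * h * w1 - 4 * y1 * z - 4"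
        using x1 det1 by (simp only: dvd_add dvd_mult dvd_mult2)
      moreover have "h * z * h * w1 - 2 * h * w1 * z - (h * h - 1) * z * w1 = (- z * w1) * ?A"
        by (simp add: algebra_simps)
      then have "p dvd h * z * h * w1 - 2 * h * w1 * z - (h * h - 1) * z * w1"
        using h by (simp only: dvd_mult)
      moreover have "2 * h * w1 * x1 - h * z * h * y1 - h * h = x1 * (2 * h * w1 - h * h * w1) + h * h * ?B"
        by (simp add: algebra_simps)
      then have "p dvd 2 * h * w1 * x1 - h * z * h * y1 - h * h"
        using x1 det1 by (simp only: dvd_add dvd_mult dvd_mult2)
      ultimately show ?thesis
        using x1 by (simp add: cong_iff_dvd_diff algebra_simps)
    qed
  qed
  let ?e = "(h * h - 1) * z * w1" and ?q = "h * h"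
  have q: "p dvd 4 * ?q - 1"
  proof -
    have "4 * ?q - 1 = (2 * h + 1) * (2 * h - 1)" by (simp add: algebra_simps)
    then show ?thesis using h by simp
  qed
  \<comment> \<open>Commutators of lower triangular matrices are unipotent, so this one, with
    \<open>lower 1\<close>, is a transvection.\<close>
  from mult[OF conj[OF C lower_SL2[of 1]] adjQ[OF C]]
  have "Q (lower (1 - ?q * ?q))"
  proof (rule congQ)
    have "?q * (4 + ?e - ?q) - ?q * ?e - (1 - ?q * ?q) = 4 * ?q - 1"
      by (simp add: algebra_simps)
    then show "cong2 p (lower 1 \<star> (4, 0, ?e, ?q) \<star> adj (lower 1) \<star> adj (4, 0, ?e, ?q)) (lower (1 - ?q * ?q))"
      using q by (simp add: lower_def cong_iff_dvd_diff algebra_simps)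
  qed
  \<comment> \<open>As \<open>4 * ?q\<close> is 1 modulo \<open>p\<close>, sixteen times this entry
    is 15, and \<open>p > 5\<close> excludes the prime divisors 3 and 5.\<close>
  moreover have "\<not> p dvd 1 - ?q * ?q"
  proof
    assume "p dvd 1 - ?q * ?q"
    then have "p dvd 16 * (1 - ?q * ?q) + (4 * ?q + 1) * (4 * ?q - 1)"
      using q by (intro dvd_add dvd_mult)
    also have "\<dots> = 3 * 5" by (simp add: algebra_simps)
    finally have "p dvd 3 * 5" .
    then show False
      using prime_p not_dvd[of 3] not_dvd[of 5] prime_dvd_mult_iff[of p 3 5] by simp
  qed
  ultimately have low: "Q (lower k)" for k
    using lower_multiples(1)[of Q] mult resp by blast
  have up: "Q (upper k)" for k
  proof -
    have "(0, -1, 1, 0) \<in> SL2 p" by (simp add: SL2_def)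
    from conj[OF low this, of "- k"] show ?thesis by (simp add: lower_def upper_def)
  qed
  have "Q M" if "M \<in> SL2 p" for M
    by (rule SL2_generated[of Q]) (use mult resp low up that in blast)+
  then show ?thesis
    using subgroup.subset[OF sub] by (auto simp: Q_def carrier_PSL2)
qed

section \<open>The generating triple in PSL(2, p)\<close>

context prime_mod begin

text \<open>\<open>mat_a\<close> and \<open>mat_b\<close> have determinant 1 and trace -1, hence
  cube one; exchanging coordinates inverts both. A square root \<open>i\<close> of -1 modulo
  \<open>p\<close> makes the determinant of \<open>mat_t i\<close> one.\<close>

definition mat_a :: mat2 where "mat_a = (0, -1, 1, -1)"
definition mat_b :: mat2 where "mat_b = (-1, -1, 1, 0)"
definition mat_t :: "int \<Rightarrow> mat2" where "mat_t i = (0, i, i, 0)"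

text \<open>Up to sign the two products of \<open>mat_a\<close> and \<open>mat_b\<close> are
  \<open>lower 2\<close> and \<open>upper (- 2)\<close>, whose multiples are all transvections since
  2 is invertible.\<close>

lemma PSL2_generated_ab:
  assumes p2: "2 < p" and sub: "subgroup S (PSL2 p)"
    and aS: "pcls p mat_a \<in> S" and bS: "pcls p mat_b \<in> S"
  shows "S = carrier (PSL2 p)"
proof -
  define Q where "Q M \<longleftrightarrow> pcls p M \<in> S" for M
  have mult: "Q (M \<star> M')" if "Q M" "Q M'" for M M'
    using subgroup.m_closed[OF sub] that unfolding Q_def by fastforce
  have resp: "Q M'" if "Q M" "pm_cong p M M'" for M M'
    using that pcls_eq_iff unfolding Q_def by metis
  have Qab: "Q mat_a" "Q mat_b"
    using aS bS by (simp_all add: Q_def)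
  have dvd2: "\<not> p dvd 2" "\<not> p dvd - 2"
    using p2 zdvd_imp_le[of p 2] by auto
  have "pm_cong p (mat_a \<star> mat_b) (lower 2)" "pm_cong p (mat_b \<star> mat_a) (upper (- 2))"
    by (simp_all add: mat_a_def mat_b_def pm_cong_def lower_def upper_def)
  then have "Q (lower 2)" "Q (upper (- 2))"
    using resp mult Qab by blast+
  note gens = this
  have low: "Q (lower k)" for k
    by (rule lower_multiples(1)[of Q 2]) (use mult resp dvd2 gens in blast)+
  have up: "Q (upper k)" for k
    by (rule lower_multiples(2)[of Q "- 2"]) (use mult resp dvd2 gens in blast)+
  have "Q M" if "M \<in> SL2 p" for M
    by (rule SL2_generated[of Q]) (use mult resp low up that in blast)+
  then show ?thesis
    using subgroup.subset[OF sub] by (auto simp: Q_def carrier_PSL2)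
qed

lemma PSL2_generating_triple:
  assumes p11: "11 < p" and i: "p dvd i * i + 1" and h: "[2 * h = 1] (mod p)"
  shows "generating_triple (PSL2 p) (pcls p mat_a) (pcls p mat_b) (pcls p (mat_t i)) (pcls p (h, 0, 0, 2))"
proof -
  have ab_SL: "mat_a \<in> SL2 p" "mat_b \<in> SL2 p"
    by (simp_all add: mat_a_def mat_b_def SL2_def)
  have t_SL: "mat_t i \<in> SL2 p"
  proof -
    have "- (i * i) - 1 = - (i * i + 1)" by simp
    then have "p dvd - (i * i) - 1" using i by (simp only: dvd_minus_iff)
    then show ?thesis by (simp add: mat_t_def SL2_def cong_iff_dvd_diff)
  qed
  have d_SL: "(h, 0, 0, 2) \<in> SL2 p"
    using h by (simp add: SL2_def mult.commute)
  have not_dvd: "\<not> p dvd k" if "0 < k" "k \<le> 11" for k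
    using zdvd_imp_le[of p k] that p11 by auto
  note nd = not_dvd[of 1] not_dvd[of 2]
  have t_sq: "[i * i = - 1] (mod p)"
    using i by (simp add: cong_iff_dvd_diff)
  show ?thesis
  proof (intro generating_triple.intro generating_triple_axioms.intro)
    show "group (PSL2 p)" by (rule group_PSL2)
    show "finite (carrier (PSL2 p))" using p11 by (simp add: finite_PSL2)
    show "pcls p mat_a \<in> carrier (PSL2 p)" "pcls p mat_b \<in> carrier (PSL2 p)"
      "pcls p (mat_t i) \<in> carrier (PSL2 p)" "pcls p (h, 0, 0, 2) \<in> carrier (PSL2 p)"
      using ab_SL t_SL d_SL by simp_all
    show "pcls p mat_a \<otimes>\<^bsub>PSL2 p\<^esub> pcls p mat_a \<otimes>\<^bsub>PSL2 p\<^esub> pcls p mat_a = \<one>\<^bsub>PSL2 p\<^esub>"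
      "pcls p mat_b \<otimes>\<^bsub>PSL2 p\<^esub> pcls p mat_b \<otimes>\<^bsub>PSL2 p\<^esub> pcls p mat_b = \<one>\<^bsub>PSL2 p\<^esub>"
      by (simp_all add: mat_a_def mat_b_def one_PSL2)
    show "pcls p (mat_t i) \<otimes>\<^bsub>PSL2 p\<^esub> pcls p (mat_t i) = \<one>\<^bsub>PSL2 p\<^esub>"
      using t_sq by (simp add: mat_t_def one_PSL2 pcls_eq_iff pm_cong_def)
    show "pcls p (mat_t i) \<otimes>\<^bsub>PSL2 p\<^esub> pcls p mat_a =
        pcls p mat_a \<otimes>\<^bsub>PSL2 p\<^esub> pcls p mat_a \<otimes>\<^bsub>PSL2 p\<^esub> pcls p (mat_t i)"
      "pcls p (mat_t i) \<otimes>\<^bsub>PSL2 p\<^esub> pcls p mat_b =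
        pcls p mat_b \<otimes>\<^bsub>PSL2 p\<^esub> pcls p mat_b \<otimes>\<^bsub>PSL2 p\<^esub> pcls p (mat_t i)"
      by (simp_all add: mat_a_def mat_b_def mat_t_def)
    show "pcls p mat_a \<noteq> \<one>\<^bsub>PSL2 p\<^esub>" "pcls p mat_b \<noteq> \<one>\<^bsub>PSL2 p\<^esub>"
      "pcls p mat_a \<noteq> pcls p mat_b" "pcls p mat_a \<noteq> pcls p mat_b \<otimes>\<^bsub>PSL2 p\<^esub> pcls p mat_b"
      using nd by (auto simp: mat_a_def mat_b_def one_PSL2 pcls_eq_iff pm_cong_def cong_iff_dvd_diff)
    show "N = carrier (PSL2 p)" if "N \<lhd> PSL2 p" "N \<noteq> {\<one>\<^bsub>PSL2 p\<^esub>}" for N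
      using PSL2_simple[OF _ that] p11 by simp
    show "S = carrier (PSL2 p)"
      if "subgroup S (PSL2 p)" "pcls p mat_a \<in> S" "pcls p mat_b \<in> S" for S
      using PSL2_generated_ab[OF _ that] p11 by simp
    \<comment> \<open>Up to sign \<open>mat_a \<star> mat_b\<close> is \<open>lower 2\<close>;
      conjugation by this diagonal matrix multiplies the entry by 4, as does the fourth
      power.\<close>
    show "pcls p (h, 0, 0, 2) \<otimes>\<^bsub>PSL2 p\<^esub> (pcls p mat_a \<otimes>\<^bsub>PSL2 p\<^esub> pcls p mat_b) \<otimes>\<^bsub>PSL2 p\<^esub>
        inv\<^bsub>PSL2 p\<^esub> pcls p (h, 0, 0, 2) = (pcls p mat_a \<otimes>\<^bsub>PSL2 p\<^esub> pcls p mat_b) [^]\<^bsub>PSL2 p\<^esub> (4::nat)"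
    proof -
      have "[- (2 * h) = - 1] (mod p)"
        using h by (simp add: cong_minus_minus_iff)
      then have "pm_cong p ((h, 0, 0, 2) \<star> (mat_a \<star> mat_b) \<star> adj (h, 0, 0, 2)) (1, 0, 8, 1)"
        by (simp add: mat_a_def mat_b_def pm_cong_def mult.commute)
      then show ?thesis
        using d_SL by (simp add: pcls_eq_iff eval_nat_numeral mat_a_def mat_b_def one_PSL2)
    qed
    show "X \<otimes>\<^bsub>PSL2 p\<^esub> (pcls p mat_b \<otimes>\<^bsub>PSL2 p\<^esub> (pcls p mat_a \<otimes>\<^bsub>PSL2 p\<^esub> pcls p mat_a)) \<otimes>\<^bsub>PSL2 p\<^esub> inv\<^bsub>PSL2 p\<^esub> X
        \<noteq> (pcls p mat_b \<otimes>\<^bsub>PSL2 p\<^esub> (pcls p mat_a \<otimes>\<^bsub>PSL2 p\<^esub> pcls p mat_a)) [^]\<^bsub>PSL2 p\<^esub> (4::nat)"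
      if X: "X \<in> carrier (PSL2 p)" for X
    proof
      assume eq: "X \<otimes>\<^bsub>PSL2 p\<^esub> (pcls p mat_b \<otimes>\<^bsub>PSL2 p\<^esub> (pcls p mat_a \<otimes>\<^bsub>PSL2 p\<^esub> pcls p mat_a)) \<otimes>\<^bsub>PSL2 p\<^esub> inv\<^bsub>PSL2 p\<^esub> X
        = (pcls p mat_b \<otimes>\<^bsub>PSL2 p\<^esub> (pcls p mat_a \<otimes>\<^bsub>PSL2 p\<^esub> pcls p mat_a)) [^]\<^bsub>PSL2 p\<^esub> (4::nat)"
      let ?m = "(2, -1, -1, 1) :: mat2"
      have m: "mat_b \<star> (mat_a \<star> mat_a) = ?m"
        by (simp add: mat_a_def mat_b_def)
      obtain g where g: "g \<in> SL2 p" "X = pcls p g"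
        using X unfolding carrier_PSL2 by blast
      have "pcls p (g \<star> ?m \<star> adj g) = pcls p (34, -21, -21, 13)"
        using eq g m by (simp add: eval_nat_numeral one_PSL2)
      then obtain s where s: "s \<in> {1, -1}" "cong2 p (g \<star> ?m \<star> adj g) (smult2 s (34, -21, -21, 13))"
        unfolding pcls_eq_iff pm_cong_def by blast
      \<comment> \<open>In the quotient the trace is a conjugation invariant up to sign. Here 3
        congruent to 47 or -47 would make \<open>p\<close> divide 44 or 50, whose prime factors do
        not exceed 11.\<close>
      have "[tr2 (g \<star> ?m \<star> adj g) = s * 47] (mod p)"
        using cong2_tr2[OF s(2)] by (simp add: algebra_simps)
      moreover have "tr2 (g \<star> ?m \<star> adj g) = 3 * det2 g"
        by (cases g) (simp add: algebra_simps)
      moreover have "[3 * det2 g = 3 * 1] (mod p)"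
        using g(1) unfolding SL2_def by (intro cong_mult) auto
      ultimately have "[3 = s * 47] (mod p)"
        by (metis cong_sym cong_trans mult.right_neutral)
      then have "p dvd 3 - s * 47"
        by (simp add: cong_iff_dvd_diff)
      then have "p dvd 44 \<or> p dvd 50"
        using s(1) by auto
      moreover have "\<not> p dvd 44"
        using prime_dvd_mult_iff[of p 4 11] prime_p not_dvd[of 4] not_dvd[of 11] by simp
      moreover have "\<not> p dvd 50"
        using prime_dvd_mult_iff[of p 5 10] prime_p not_dvd[of 5] not_dvd[of 10] by simp
      ultimately show False by blast
    qed
  qed
qed

end

section \<open>Infinitely many pairwise non-isomorphic graphs\<close>

lemma digraph_iso_card_verts:
  assumes "digraph_iso (with_proj \<Gamma>) (with_proj \<Gamma>')"
  shows "card (pverts \<Gamma>) = card (pverts \<Gamma>')"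
proof -
  obtain f where f: "pre_digraph.digraph_isomorphism (with_proj \<Gamma>) f" "with_proj \<Gamma>' = app_iso f (with_proj \<Gamma>)"
    using assms by (auto simp: digraph_iso_def)
  then have "inj_on (iso_verts f) (pverts \<Gamma>)"
    by (simp add: pre_digraph.digraph_isomorphism_def)
  moreover have "pverts \<Gamma>' = iso_verts f ` pverts \<Gamma>"
    using f(2) verts_app_iso[of f "with_proj \<Gamma>"] by (metis with_proj_simps(1))
  ultimately show ?thesis
    by (simp add: card_image)
qed

text \<open>Euclid's argument for the square of the factorial of \<open>n\<close> plus one: no prime
  up to \<open>n\<close> divides it, and the factorial itself serves as \<open>i\<close>.\<close>

lemma ex_prime_dvd_square_plus_one:
  "\<exists>p i :: int. prime p \<and> int n < p \<and> p dvd i * i + 1"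
proof -
  let ?i = "fact n :: nat"
  have "?i * ?i + 1 \<noteq> 1" by simp
  then obtain q where q: "prime q" "q dvd ?i * ?i + 1"
    using prime_factor_nat by blast
  have "n < q"
  proof (rule ccontr)
    assume "\<not> n < q"
    then have "q dvd ?i"
      using prime_ge_1_nat[OF q(1)] by (intro dvd_fact) simp_all
    then have "q dvd ?i * ?i" by (rule dvd_mult)
    then have "q dvd 1" using q(2) dvd_add_right_iff by blast
    then show False using q(1) by simp
  qed
  moreover have "int q dvd int ?i * int ?i + 1"
    using q(2) by (metis int_dvd_int_iff of_nat_1 of_nat_add of_nat_mult)
  ultimately show ?thesis
    using q(1) by (intro exI[of _ "int q"] exI[of _ "int ?i"]) simp
qed

theorem theorem1p1:
  shows "\<exists>\<G> :: nat pair_pre_digraph set.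
    infinite \<G> \<and>
    pairwise (\<lambda>\<Gamma> \<Gamma>'. \<not> digraph_iso (with_proj \<Gamma>) (with_proj \<Gamma>')) \<G> \<and>
    (\<forall>\<Gamma> \<in> \<G>.
       pair_graph \<Gamma> \<and> connected (with_proj \<Gamma>) \<and> regular_of_valency \<Gamma> 3 \<and>
       (\<exists>A B. bipartition \<Gamma> A B \<and>
          (\<exists>G. subgroup G (GraphAutoGroup \<Gamma>) \<and>
             s_arc_transitive \<Gamma> G 2 \<and>
             biquasiprimitive (pverts \<Gamma>) G \<and>
             \<not> quasiprimitive_on (even_subgroup \<Gamma> G) A \<and>
             \<not> quasiprimitive_on (even_subgroup \<Gamma> G) B)))"
proof -
  define good :: "nat pair_pre_digraph \<Rightarrow> bool" where "good \<Gamma> \<longleftrightarrow>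
       pair_graph \<Gamma> \<and> connected (with_proj \<Gamma>) \<and> regular_of_valency \<Gamma> 3 \<and>
       (\<exists>A B. bipartition \<Gamma> A B \<and>
          (\<exists>G. subgroup G (GraphAutoGroup \<Gamma>) \<and>
             s_arc_transitive \<Gamma> G 2 \<and>
             biquasiprimitive (pverts \<Gamma>) G \<and>
             \<not> quasiprimitive_on (even_subgroup \<Gamma> G) A \<and>
             \<not> quasiprimitive_on (even_subgroup \<Gamma> G) B))" for \<Gamma>
  have large: "\<exists>\<Gamma>. good \<Gamma> \<and> n < card (pverts \<Gamma>)" for n
  proof -
    \<comment> \<open>The bound 11 serves the trace comparison, the bound \<open>n\<close> the size
      of the group and so of the graph.\<close>
    obtain p i where p: "prime p" "int (max 11 n) < p" "p dvd i * i + 1"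
      using ex_prime_dvd_square_plus_one by blast
    interpret prime_mod p by standard (rule p(1))
    have "\<not> p dvd 2"
      using p(2) zdvd_imp_le[of p 2] by auto
    then obtain h where h: "[2 * h = 1] (mod p)"
      by (rule inverse_mod)
    interpret generating_triple "PSL2 p" "pcls p mat_a" "pcls p mat_b" "pcls p (mat_t i)" "pcls p (h, 0, 0, 2)"
      by (rule PSL2_generating_triple[OF _ p(3) h]) (use p(2) in simp)
    obtain \<Gamma> where "good \<Gamma>" "card (carrier (PSL2 p)) \<le> card (pverts \<Gamma>)"
      using ex_cubic_graph unfolding good_def by blast
    moreover have "n < card (carrier (PSL2 p))"
      using card_PSL2[of p] p(2) by linarith
    ultimately show ?thesis by (meson less_le_trans)
  qed
  \<comment> \<open>One graph is chosen for each attained number of vertices, so that distinct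
    members are told apart by counting vertices.\<close>
  define C where "C = (\<lambda>\<Gamma>. card (pverts \<Gamma>)) ` {\<Gamma>. good \<Gamma>}"
  define rep where "rep c = (SOME \<Gamma>. good \<Gamma> \<and> card (pverts \<Gamma>) = c)" for c
  have rep: "good (rep c) \<and> card (pverts (rep c)) = c" if "c \<in> C" for c
    unfolding rep_def by (rule someI_ex) (use that in \<open>auto simp: C_def\<close>)
  have "infinite C"
    unfolding infinite_nat_iff_unbounded using large by (fastforce simp: C_def)
  moreover have "inj_on rep C"
    using rep by (metis inj_onI)
  ultimately have "infinite (rep ` C)"
    using finite_imageD by blast
  moreover have "pairwise (\<lambda>\<Gamma> \<Gamma>'. \<not> digraph_iso (with_proj \<Gamma>) (with_proj \<Gamma>')) (rep ` C)"
  proof (rule pairwiseI)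
    fix \<Gamma> \<Gamma>' assume "\<Gamma> \<in> rep ` C" "\<Gamma>' \<in> rep ` C" "\<Gamma> \<noteq> \<Gamma>'"
    then have "card (pverts \<Gamma>) \<noteq> card (pverts \<Gamma>')"
      using rep by auto
    then show "\<not> digraph_iso (with_proj \<Gamma>) (with_proj \<Gamma>')"
      using digraph_iso_card_verts by blast
  qed
  moreover have "\<forall>\<Gamma>\<in>rep ` C. good \<Gamma>"
    using rep by blast
  ultimately show ?thesis
    unfolding good_def by blast
qed

end
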